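(* Let $(V,Q_1,\dots,Q_n,\dots)$ be an $A_\infty$ algebra, together with a decomposition of $V$ as a direct sum of graded subspaces $V=X\oplus Y$ such that $\mathbf{s}Y\subset Q_1(\mathbf{s}X)$. Let $(W,R_1,\dots,R_n,\dots)$ be a second $A_\infty$ algebra and $G,G':V\to W$ two $A_\infty$ morphisms such that (1) the linear parts of $G$ and $G'$ are equal, and (2) for all $n$ and $v_1,\dots,v_n\in V$, whenever there exists $1\le i\le n$ such that $v_i\in X$, then $G_n(\mathbf{s}v_1\otimes\cdots\otimes\mathbf{s}v_n)=G'_n(\mathbf{s}v_1\otimes\cdots\otimes\mathbf{s}v_n)$. Under these conditions, the morphisms $G$ and $G'$ coincide. In particular, if there exists an $A_\infty$ morphism $F:V\to W$ with a given linear part and the property that its higher Taylor coefficients $F_n$, $n\ge2$, vanish whenever at least one of their arguments is in $\mathbf{s}X$, it is unique.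
   Context: Vector spaces are over a field $\Bbbk$ of characteristic zero. For a graded vector space $V$, $\mathbf{s}V$ is the suspension, $(\mathbf{s}V)^i=V^{i+1}$. $\overline{T}(V)=\bigoplus_{n\ge1}V^{\otimes n}$ carries the deconcatenation coproduct. An $A_\infty$ algebra structure on $V$ is a degree $1$ coderivation $Q$ of $\overline{T}(\mathbf{s}V)$ with $Q^2=0$; it is determined by its Taylor coefficients $Q_n:(\mathbf{s}V)^{\otimes n}\to\mathbf{s}V$ (restriction to $(\mathbf{s}V)^{\otimes n}$ followed by projection onto $\mathbf{s}V$). An $A_\infty$ morphism $F:V\to W$ is a morphism of dg coalgebras $\overline{T}(\mathbf{s}V)\to\overline{T}(\mathbf{s}W)$, determined by its Taylor coefficients $F_n:(\mathbf{s}V)^{\otimes n}\to\mathbf{s}W$; $F_1$ is its linear part. *)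

theory Defs
  imports Complex_Main "HOL-Library.Function_Algebras"
begin

section \<open>Tensor products and tensor coalgebras over a field\<close>

text \<open>
  A vector space is a type with a scalar multiplication (locale \<^locale>\<open>vector_space\<close>).
  Since types cannot depend on a scalar multiplication, tensor products are realised as
  subspaces of a fixed ambient function space: a pure tensor is the evaluation functional at
  the given tuple of vectors on the space of all multilinear forms, and the tensor product is
  the span of the pure tensors. Over a field this is the usual tensor product, because
  multilinear forms separate tensors; the universal properties are proved below
  (\<open>lift_T_pure\<close>, \<open>linear_on_eq_bar_T\<close>, \<open>tensor_universal\<close>, \<open>linear_on_eq_tensor\<close>).
\<close>

definition fscale :: "'k::field \<Rightarrow> ('i \<Rightarrow> 'k) \<Rightarrow> 'i \<Rightarrow> 'k" where
  "fscale c f = (\<lambda>i. c * f i)"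

definition evaluation :: "('i \<Rightarrow> 'k::field) set \<Rightarrow> 'i \<Rightarrow> ('i \<Rightarrow> 'k) \<Rightarrow> 'k" where
  "evaluation M i = (\<lambda>\<phi>. if \<phi> \<in> M then \<phi> i else 0)"

definition linear_on ::
  "('k::field \<Rightarrow> 'a::ab_group_add \<Rightarrow> 'a) \<Rightarrow> ('k \<Rightarrow> 'b::ab_group_add \<Rightarrow> 'b) \<Rightarrow> 'a set \<Rightarrow> 'b set \<Rightarrow> ('a \<Rightarrow> 'b) \<Rightarrow> bool"
where
  "linear_on s1 s2 A B f \<longleftrightarrow> (\<forall>x\<in>A. f x \<in> B) \<and>
     (\<forall>x\<in>A. \<forall>y\<in>A. f (x + y) = f x + f y) \<and> (\<forall>c. \<forall>x\<in>A. f (s1 c x) = s2 c (f x))"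

text \<open>A function on lists is multilinear if its restriction to lists of each length
  \<open>n \<ge> 1\<close> is; the value at the empty list is unconstrained.\<close>

definition multilinear ::
  "('k::field \<Rightarrow> 'v::ab_group_add \<Rightarrow> 'v) \<Rightarrow> ('k \<Rightarrow> 'u::ab_group_add \<Rightarrow> 'u) \<Rightarrow> ('v list \<Rightarrow> 'u) \<Rightarrow> bool"
where
  "multilinear s s' h \<longleftrightarrow> (\<forall>xs ys. Vector_Spaces.linear s s' (\<lambda>v. h (xs @ v # ys)))"

text \<open>\<open>pure s [v\<^sub>1, \<dots>, v\<^sub>n]\<close> is \<open>v\<^sub>1 \<otimes> \<cdots> \<otimes> v\<^sub>n\<close>, and \<open>bar_T s\<close> is
  the direct sum of the tensor powers of exponent \<open>n \<ge> 1\<close>.\<close>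

type_synonym ('v, 'k) tens = "('v list \<Rightarrow> 'k) \<Rightarrow> 'k"

definition pure :: "('k::field \<Rightarrow> 'v::ab_group_add \<Rightarrow> 'v) \<Rightarrow> 'v list \<Rightarrow> ('v, 'k) tens" where
  "pure s = evaluation {\<phi>. multilinear s (*) \<phi>}"

definition bar_T :: "('k::field \<Rightarrow> 'v::ab_group_add \<Rightarrow> 'v) \<Rightarrow> ('v, 'k) tens set" where
  "bar_T s = module.span fscale (pure s ` {w. w \<noteq> []})"

text \<open>The linear map on \<open>bar_T s\<close> induced by a multilinear \<open>h\<close> (it is irrelevant outside of
  \<open>bar_T s\<close>).\<close>

definition lift_T ::
  "('k::field \<Rightarrow> 'v::ab_group_add \<Rightarrow> 'v) \<Rightarrow> ('k \<Rightarrow> 'u::ab_group_add \<Rightarrow> 'u) \<Rightarrow> ('v list \<Rightarrow> 'u) \<Rightarrow> ('v, 'k) tens \<Rightarrow> 'u"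
where
  "lift_T s s' h = (SOME f. Vector_Spaces.linear fscale s' f \<and> (\<forall>w. w \<noteq> [] \<longrightarrow> f (pure s w) = h w))"

text \<open>The tensor product of two subspaces \<open>A\<close> and \<open>B\<close> of function spaces.\<close>

type_synonym ('a, 'b, 'k) tens2 = "('a \<times> 'b \<Rightarrow> 'k) \<Rightarrow> 'k"

definition bilinear_on ::
  "('i \<Rightarrow> 'k::field) set \<Rightarrow> ('j \<Rightarrow> 'k) set \<Rightarrow> ('k \<Rightarrow> 'u::ab_group_add \<Rightarrow> 'u) \<Rightarrow> (('i \<Rightarrow> 'k) \<times> ('j \<Rightarrow> 'k) \<Rightarrow> 'u) \<Rightarrow> bool"
where
  "bilinear_on A B s \<beta> \<longleftrightarrow>
     (\<forall>a\<in>A. linear_on fscale s B UNIV (\<lambda>b. \<beta> (a, b))) \<and>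
     (\<forall>b\<in>B. linear_on fscale s A UNIV (\<lambda>a. \<beta> (a, b)))"

definition pure2 ::
  "('i \<Rightarrow> 'k::field) set \<Rightarrow> ('j \<Rightarrow> 'k) set \<Rightarrow> ('i \<Rightarrow> 'k) \<Rightarrow> ('j \<Rightarrow> 'k) \<Rightarrow> ('i \<Rightarrow> 'k, 'j \<Rightarrow> 'k, 'k) tens2"
where
  "pure2 A B a b = evaluation {\<beta>. bilinear_on A B (*) \<beta>} (a, b)"

definition tensor ::
  "('i \<Rightarrow> 'k::field) set \<Rightarrow> ('j \<Rightarrow> 'k) set \<Rightarrow> ('i \<Rightarrow> 'k, 'j \<Rightarrow> 'k, 'k) tens2 set"
where
  "tensor A B = module.span fscale {pure2 A B a b | a b. a \<in> A \<and> b \<in> B}"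

text \<open>The (reduced) deconcatenation coproduct on \<open>bar_T s\<close>.\<close>

definition deconcat ::
  "('k::field \<Rightarrow> 'v::ab_group_add \<Rightarrow> 'v) \<Rightarrow> ('v, 'k) tens \<Rightarrow> (('v, 'k) tens, ('v, 'k) tens, 'k) tens2"
where
  "deconcat s = lift_T s fscale
     (\<lambda>w. \<Sum>i\<in>{1..<length w}. pure2 (bar_T s) (bar_T s) (pure s (take i w)) (pure s (drop i w)))"

text \<open>The projection of \<open>bar_T s\<close> onto its summand of tensor exponent \<open>1\<close>.\<close>

definition proj1 :: "('k::field \<Rightarrow> 'v::ab_group_add \<Rightarrow> 'v) \<Rightarrow> ('v, 'k) tens \<Rightarrow> 'v" where
  "proj1 s = lift_T s s (\<lambda>w. if length w = 1 then hd w else 0)"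


section \<open>Gradings\<close>

definition graded_vector_space ::
  "('k::field \<Rightarrow> 'v::ab_group_add \<Rightarrow> 'v) \<Rightarrow> (int \<Rightarrow> 'v set) \<Rightarrow> bool"
where
  "graded_vector_space s gr \<longleftrightarrow> vector_space s \<and> (\<forall>i. module.subspace s (gr i)) \<and>
     (\<forall>v. \<exists>!c. finite {i. c i \<noteq> 0} \<and> (\<forall>i. c i \<in> gr i) \<and> v = (\<Sum>i | c i \<noteq> 0. c i))"

definition graded_subspace ::
  "('k::field \<Rightarrow> 'v::ab_group_add \<Rightarrow> 'v) \<Rightarrow> (int \<Rightarrow> 'v set) \<Rightarrow> 'v set \<Rightarrow> bool"
where
  "graded_subspace s gr X \<longleftrightarrow> module.subspace s X \<and> X = module.span s (\<Union>i. X \<inter> gr i)"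

definition direct_sum_decomposition :: "'v::ab_group_add set \<Rightarrow> 'v set \<Rightarrow> bool" where
  "direct_sum_decomposition X Y \<longleftrightarrow> X \<inter> Y = {0} \<and> (\<forall>v. \<exists>x\<in>X. \<exists>y\<in>Y. v = x + y)"

text \<open>The suspension has the same underlying vector space, so \<open>v \<mapsto> \<^bold>s v\<close> is the identity
  on elements and only the grading changes.\<close>

definition suspension :: "(int \<Rightarrow> 'v set) \<Rightarrow> int \<Rightarrow> 'v set" where
  "suspension gr i = gr (i + 1)"

definition bar_T_deg ::
  "('k::field \<Rightarrow> 'v::ab_group_add \<Rightarrow> 'v) \<Rightarrow> (int \<Rightarrow> 'v set) \<Rightarrow> int \<Rightarrow> ('v, 'k) tens set"
where
  "bar_T_deg s gr d = module.span fscale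
     {pure s w | w ds. w \<noteq> [] \<and> list_all2 (\<lambda>v e. v \<in> gr e) w ds \<and> sum_list ds = d}"

definition homogeneous_map :: "int \<Rightarrow> (int \<Rightarrow> 'a set) \<Rightarrow> (int \<Rightarrow> 'b set) \<Rightarrow> ('a \<Rightarrow> 'b) \<Rightarrow> bool" where
  "homogeneous_map p gr gr' f \<longleftrightarrow> (\<forall>d. \<forall>x\<in>gr d. f x \<in> gr' (d + p))"

text \<open>\<open>tensor_map s gr s' f p g\<close> is \<open>f \<otimes> g\<close> for maps \<open>f, g\<close> from \<open>bar_T s\<close> to \<open>bar_T s'\<close>,
  where \<open>g\<close> has degree \<open>p\<close>, with the Koszul sign:
  \<open>(f \<otimes> g) (a \<otimes> b) = (-1)^(p |a|) f a \<otimes> g b\<close>.\<close>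

definition koszul_sign :: "int \<Rightarrow> 'k::field" where
  "koszul_sign n = (if even n then 1 else - 1)"

definition tensor_map ::
  "('k::field \<Rightarrow> 'v::ab_group_add \<Rightarrow> 'v) \<Rightarrow> (int \<Rightarrow> 'v set) \<Rightarrow> ('k \<Rightarrow> 'w::ab_group_add \<Rightarrow> 'w) \<Rightarrow>
   (('v, 'k) tens \<Rightarrow> ('w, 'k) tens) \<Rightarrow> int \<Rightarrow> (('v, 'k) tens \<Rightarrow> ('w, 'k) tens) \<Rightarrow>
   (('v, 'k) tens, ('v, 'k) tens, 'k) tens2 \<Rightarrow> (('w, 'k) tens, ('w, 'k) tens, 'k) tens2"
where
  "tensor_map s gr s' f p g = (SOME h.
     linear_on fscale fscale (tensor (bar_T s) (bar_T s)) (tensor (bar_T s') (bar_T s')) h \<and>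
     (\<forall>d. \<forall>a \<in> bar_T_deg s gr d. \<forall>b \<in> bar_T s.
        h (pure2 (bar_T s) (bar_T s) a b) =
        fscale (koszul_sign (p * d)) (pure2 (bar_T s') (bar_T s') (f a) (g b))))"


section \<open>A-infinity algebras and morphisms\<close>

definition coderivation ::
  "('k::field \<Rightarrow> 'v::ab_group_add \<Rightarrow> 'v) \<Rightarrow> (int \<Rightarrow> 'v set) \<Rightarrow> int \<Rightarrow> (('v, 'k) tens \<Rightarrow> ('v, 'k) tens) \<Rightarrow> bool"
where
  "coderivation s gr p Q \<longleftrightarrow>
     linear_on fscale fscale (bar_T s) (bar_T s) Q \<and>
     homogeneous_map p (bar_T_deg s gr) (bar_T_deg s gr) Q \<and>
     (\<forall>t \<in> bar_T s. deconcat s (Q t) =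
        tensor_map s gr s Q 0 id (deconcat s t) + tensor_map s gr s id p Q (deconcat s t))"

definition A_infinity_algebra ::
  "('k::field_char_0 \<Rightarrow> 'v::ab_group_add \<Rightarrow> 'v) \<Rightarrow> (int \<Rightarrow> 'v set) \<Rightarrow> (('v, 'k) tens \<Rightarrow> ('v, 'k) tens) \<Rightarrow> bool"
where
  "A_infinity_algebra s gr Q \<longleftrightarrow> graded_vector_space s gr \<and>
     coderivation s (suspension gr) 1 Q \<and> (\<forall>t \<in> bar_T s. Q (Q t) = 0)"

definition A_infinity_morphism ::
  "('k::field_char_0 \<Rightarrow> 'v::ab_group_add \<Rightarrow> 'v) \<Rightarrow> (int \<Rightarrow> 'v set) \<Rightarrow> (('v, 'k) tens \<Rightarrow> ('v, 'k) tens) \<Rightarrow>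
   ('k \<Rightarrow> 'w::ab_group_add \<Rightarrow> 'w) \<Rightarrow> (int \<Rightarrow> 'w set) \<Rightarrow> (('w, 'k) tens \<Rightarrow> ('w, 'k) tens) \<Rightarrow>
   (('v, 'k) tens \<Rightarrow> ('w, 'k) tens) \<Rightarrow> bool"
where
  "A_infinity_morphism sV grV Q sW grW R F \<longleftrightarrow>
     linear_on fscale fscale (bar_T sV) (bar_T sW) F \<and>
     homogeneous_map 0 (bar_T_deg sV (suspension grV)) (bar_T_deg sW (suspension grW)) F \<and>
     (\<forall>t \<in> bar_T sV. deconcat sW (F t) = tensor_map sV (suspension grV) sW F 0 F (deconcat sV t)) \<and>
     (\<forall>t \<in> bar_T sV. F (Q t) = R (F t))"

text \<open>\<open>taylor sV sW F [v\<^sub>1, \<dots>, v\<^sub>n]\<close> is \<open>F\<^sub>n (\<^bold>s v\<^sub>1 \<otimes> \<cdots> \<otimes> \<^bold>s v\<^sub>n)\<close>.\<close>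

definition taylor ::
  "('k::field \<Rightarrow> 'v::ab_group_add \<Rightarrow> 'v) \<Rightarrow> ('k \<Rightarrow> 'w::ab_group_add \<Rightarrow> 'w) \<Rightarrow>
   (('v, 'k) tens \<Rightarrow> ('w, 'k) tens) \<Rightarrow> 'v list \<Rightarrow> 'w"
where
  "taylor sV sW F vs = proj1 sW (F (pure sV vs))"


section \<open>Universal properties\<close>

lemma fscale_apply [simp]: "fscale c f i = c * f i"
  by (simp add: fscale_def)

lemma vector_space_fscale: "vector_space (fscale :: 'k::field \<Rightarrow> ('i \<Rightarrow> 'k) \<Rightarrow> 'i \<Rightarrow> 'k)"
  by unfold_locales (auto simp: fscale_def fun_eq_iff algebra_simps)

interpretation fs: vector_space fscale
  by (rule vector_space_fscale)

lemma vector_space_mult: "vector_space ((*) :: 'k::field \<Rightarrow> 'k \<Rightarrow> 'k)"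
  by unfold_locales (auto simp: algebra_simps)

lemma separating_functional:
  assumes "vector_space (s :: 'k::field \<Rightarrow> 'u::ab_group_add \<Rightarrow> 'u)" and "u \<noteq> 0"
  obtains l where "Vector_Spaces.linear s (*) l" and "l u = 1"
proof -
  interpret vs: vector_space s by fact
  interpret k: vector_space "(*) :: 'k \<Rightarrow> 'k \<Rightarrow> 'k" by (rule vector_space_mult)
  interpret p: vector_space_pair s "(*) :: 'k \<Rightarrow> 'k \<Rightarrow> 'k" ..
  have "vs.independent {u}" using assms(2) by simp
  from p.linear_independent_extend[OF this, of "\<lambda>_. 1"] show ?thesis using that by auto
qed

lemma evaluation_universal:
  fixes s :: "'k::field \<Rightarrow> 'u::ab_group_add \<Rightarrow> 'u" and M :: "('i \<Rightarrow> 'k) set"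
  assumes vs: "vector_space s"
    and M: "\<And>l. Vector_Spaces.linear s (*) l \<Longrightarrow> (\<lambda>i. l (h i)) \<in> M"
  shows "\<exists>f. Vector_Spaces.linear fscale s f \<and> (\<forall>i\<in>I. f (evaluation M i) = h i)"
proof -
  interpret vs: vector_space s by fact
  interpret p: vector_space_pair fscale s ..
  obtain B where B: "B \<subseteq> evaluation M ` I" "fs.independent B" "evaluation M ` I \<subseteq> fs.span B"
    using fs.maximal_independent_subset by blast
  have "\<forall>b\<in>B. \<exists>i. i \<in> I \<and> b = evaluation M i" using B(1) by auto
  then obtain r where r: "\<And>b. b \<in> B \<Longrightarrow> r b \<in> I \<and> b = evaluation M (r b)" by metis
  from p.linear_independent_extend[OF B(2), of "\<lambda>b. h (r b)"] obtain f
    where f: "Vector_Spaces.linear fscale s f" "\<And>b. b \<in> B \<Longrightarrow> f b = h (r b)" by auto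
  interpret f: Vector_Spaces.linear fscale s f by fact
  have key: "x (\<lambda>i. l (h i)) = l (f x)"
    if l: "Vector_Spaces.linear s (*) l" and x: "x \<in> fs.span B" for x l
  proof -
    interpret l: Vector_Spaces.linear s "(*)" l by fact
    show ?thesis using x
    proof (induction rule: fs.span_induct_alt)
      case base
      show ?case unfolding f.zero l.zero by simp
    next
      case (step c b y)
      have "b (\<lambda>i. l (h i)) = l (h (r b))"
        using r[OF step(1)] M[OF l] by (metis evaluation_def)
      then have "(fscale c b + y) (\<lambda>i. l (h i)) = c * l (h (r b)) + l (f y)"
        using step by simp
      also have "\<dots> = l (f (fscale c b + y))"
        unfolding f.add f.scale l.add l.scale f(2)[OF step(1)] by (rule refl)
      finally show ?case .
    qed
  qed
  have "f (evaluation M i) = h i" if i: "i \<in> I" for i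
  proof (rule ccontr)
    assume "f (evaluation M i) \<noteq> h i"
    then have "f (evaluation M i) - h i \<noteq> 0" by simp
    from separating_functional[OF vs this] obtain l
      where l: "Vector_Spaces.linear s (*) l" "l (f (evaluation M i) - h i) = 1" .
    interpret l: Vector_Spaces.linear s "(*)" l by fact
    have "evaluation M i (\<lambda>i. l (h i)) = l (f (evaluation M i))"
      using key[OF l(1)] B(3) i by auto
    then show False using l(2) M[OF l(1)] by (simp add: evaluation_def l.diff)
  qed
  then show ?thesis using f(1) by blast
qed

lemma lift_T:
  assumes "multilinear s s' h" and vs: "vector_space s'"
  shows linear_lift_T: "Vector_Spaces.linear fscale s' (lift_T s s' h)"
    and lift_T_pure: "w \<noteq> [] \<Longrightarrow> lift_T s s' h (pure s w) = h w"
proof -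
  have "(\<lambda>w. l (h w)) \<in> {\<phi>. multilinear s (*) \<phi>}" if "Vector_Spaces.linear s' (*) l" for l
    using assms(1) Vector_Spaces.linear_compose[OF _ that] by (auto simp: multilinear_def comp_def)
  from evaluation_universal[OF vs this, where I="{w. w \<noteq> []}"]
  have "\<exists>f. Vector_Spaces.linear fscale s' f \<and> (\<forall>w. w \<noteq> [] \<longrightarrow> f (pure s w) = h w)"
    by (auto simp: pure_def)
  from someI_ex[OF this]
  show "Vector_Spaces.linear fscale s' (lift_T s s' h)"
    and "w \<noteq> [] \<Longrightarrow> lift_T s s' h (pure s w) = h w" by (auto simp: lift_T_def)
qed

lemma linear_on_eq_span:
  assumes f: "linear_on fscale s (fs.span S) B f" and g: "linear_on fscale s (fs.span S) B' g"
    and eq: "\<And>x. x \<in> S \<Longrightarrow> f x = g x" and x: "x \<in> fs.span S" and vs: "vector_space s"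
  shows "f x = g x"
proof -
  interpret vs: vector_space s by fact
  have "f (fscale 0 0) = s 0 (f 0)" "g (fscale 0 0) = s 0 (g 0)"
    using f g fs.span_zero[of S] unfolding linear_on_def by blast+
  then have 0: "f 0 = g 0" by (simp only: fs.scale_zero_left vs.scale_zero_left)
  from x have "x \<in> fs.span S \<and> f x = g x"
  proof (induction rule: fs.span_induct_alt)
    case base show ?case using 0 fs.span_zero by (intro conjI)
  next
    case (step c b y)
    have "fscale c b \<in> fs.span S" "b \<in> fs.span S"
      using step by (auto intro: fs.span_scale fs.span_base)
    then have "fscale c b + y \<in> fs.span S"
      "f (fscale c b + y) = s c (f b) + f y" "g (fscale c b + y) = s c (g b) + g y"
      using step f g fs.span_add unfolding linear_on_def by metis+
    then show ?case using step eq[of b] by metis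
  qed
  then show ?thesis ..
qed

lemma linear_on_eq_bar_T:
  assumes "linear_on fscale s' (bar_T s) B f" "linear_on fscale s' (bar_T s) B' g"
    and "\<And>w. w \<noteq> [] \<Longrightarrow> f (pure s w) = g (pure s w)" "vector_space s'" "t \<in> bar_T s"
  shows "f t = g t"
  using assms linear_on_eq_span[of s' "pure s ` {w. w \<noteq> []}" B f B' g t]
  by (auto simp: bar_T_def)

lemma tensor_universal:
  assumes "bilinear_on A B s h" and vs: "vector_space s"
  shows "\<exists>f. Vector_Spaces.linear fscale s f \<and> (\<forall>a\<in>A. \<forall>b\<in>B. f (pure2 A B a b) = h (a, b))"
proof -
  have "(\<lambda>p. l (h p)) \<in> {\<beta>. bilinear_on A B (*) \<beta>}" if l: "Vector_Spaces.linear s (*) l" for l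
  proof -
    interpret l: Vector_Spaces.linear s "(*)" l by fact
    show ?thesis using assms(1) by (auto simp: bilinear_on_def linear_on_def l.add l.scale)
  qed
  from evaluation_universal[OF vs this, where I="A \<times> B"] show ?thesis
    by (auto simp: pure2_def)
qed

lemma linear_on_eq_tensor:
  assumes "linear_on fscale s' (tensor A B) C f" "linear_on fscale s' (tensor A B) C' g"
    and "\<And>a b. a \<in> A \<Longrightarrow> b \<in> B \<Longrightarrow> f (pure2 A B a b) = g (pure2 A B a b)"
    and "vector_space s'" "t \<in> tensor A B"
  shows "f t = g t"
  using assms linear_on_eq_span[of s' "{pure2 A B a b |a b. a \<in> A \<and> b \<in> B}" C f C' g t]
  by (auto simp: tensor_def)

lemma multilinear_pure:
  assumes "vector_space s"
  shows "multilinear s fscale (pure s)"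
  unfolding multilinear_def
proof (intro allI)
  fix xs ys
  interpret vector_space s by fact
  interpret p: vector_space_pair s fscale ..
  have "pure s (xs @ (u + v) # ys) = pure s (xs @ u # ys) + pure s (xs @ v # ys)" for u v
  proof
    fix \<phi>
    show "pure s (xs @ (u + v) # ys) \<phi> = (pure s (xs @ u # ys) + pure s (xs @ v # ys)) \<phi>"
      by (auto simp: pure_def evaluation_def multilinear_def Vector_Spaces.linear_iff)
  qed
  moreover have "pure s (xs @ s c v # ys) = fscale c (pure s (xs @ v # ys))" for c v
  proof
    fix \<phi>
    show "pure s (xs @ s c v # ys) \<phi> = (fscale c (pure s (xs @ v # ys))) \<phi>"
      by (auto simp: pure_def evaluation_def multilinear_def Vector_Spaces.linear_iff)
  qed
  ultimately show "Vector_Spaces.linear s fscale (\<lambda>v. pure s (xs @ v # ys))"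
    using vector_space_axioms vector_space_fscale by (auto simp: Vector_Spaces.linear_iff)
qed

lemma bilinear_on_pure2: "bilinear_on A B fscale (\<lambda>(a, b). pure2 A B a b)"
proof -
  have "pure2 A B (a + a') b = pure2 A B a b + pure2 A B a' b"
    if "a \<in> A" "a' \<in> A" "b \<in> B" for a a' b
    using that by (auto simp: fun_eq_iff pure2_def evaluation_def bilinear_on_def linear_on_def)
  moreover have "pure2 A B a (b + b') = pure2 A B a b + pure2 A B a b'"
    if "a \<in> A" "b' \<in> B" "b \<in> B" for a b' b
    using that by (auto simp: fun_eq_iff pure2_def evaluation_def bilinear_on_def linear_on_def)
  moreover have "pure2 A B (fscale c a) b = fscale c (pure2 A B a b)"
    if "a \<in> A" "b \<in> B" for a b c
    using that
    by (auto simp: fun_eq_iff pure2_def evaluation_def bilinear_on_def linear_on_def)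
  moreover have "pure2 A B a (fscale c b) = fscale c (pure2 A B a b)"
    if "a \<in> A" "b \<in> B" for a b c
    using that
    by (auto simp: fun_eq_iff pure2_def evaluation_def bilinear_on_def linear_on_def)
  ultimately show ?thesis by (auto simp: bilinear_on_def linear_on_def)
qed

lemma pure_in_bar_T: "w \<noteq> [] \<Longrightarrow> pure s w \<in> bar_T s"
  by (auto simp: bar_T_def intro: fs.span_base)

lemma deconcat_pure:
  assumes vs: "vector_space s"
  shows linear_deconcat: "Vector_Spaces.linear fscale fscale (deconcat s)"
    and "w \<noteq> [] \<Longrightarrow> deconcat s (pure s w) =
      (\<Sum>i\<in>{1..<length w}. pure2 (bar_T s) (bar_T s) (pure s (take i w)) (pure s (drop i w)))"
proof -
  interpret vector_space s by fact
  interpret p: vector_space_pair s fscale ..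
  let ?T = "bar_T s"
  have ml: "Vector_Spaces.linear s fscale (\<lambda>v. pure s (xs @ v # ys))" for xs ys
    using multilinear_pure[OF vs] by (auto simp: multilinear_def)
  have l: "Vector_Spaces.linear s fscale
      (\<lambda>v. pure2 ?T ?T (pure s (take i (xs @ v # ys))) (pure s (drop i (xs @ v # ys))))"
    if i: "i \<in> {1..<length xs + Suc (length ys)}" for i xs ys
  proof (cases "i \<le> length xs")
    case True
    have "pure s (take i xs) \<in> ?T" using True i by (intro pure_in_bar_T) auto
    moreover have "pure s (drop i xs @ v # ys) \<in> ?T" for v by (intro pure_in_bar_T) auto
    ultimately show ?thesis
      using True ml[of "drop i xs" ys] bilinear_on_pure2[of ?T ?T]
      by (auto simp: Vector_Spaces.linear_iff bilinear_on_def linear_on_def vector_space_fscale)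
  next
    case False
    then obtain j where j: "i = Suc (length xs + j)"
      by (metis add_Suc_right less_imp_Suc_add not_le)
    then have "pure s (drop j ys) \<in> ?T" using i by (intro pure_in_bar_T) auto
    moreover have "pure s (xs @ v # take j ys) \<in> ?T" for v by (intro pure_in_bar_T) auto
    ultimately show ?thesis
      using j ml[of xs "take j ys"] bilinear_on_pure2[of ?T ?T]
      by (auto simp: Vector_Spaces.linear_iff bilinear_on_def linear_on_def vector_space_fscale)
  qed
  have "multilinear s fscale
     (\<lambda>w. \<Sum>i\<in>{1..<length w}. pure2 ?T ?T (pure s (take i w)) (pure s (drop i w)))"
    unfolding multilinear_def length_append length_Cons
    by (intro allI p.linear_compose_sum ballI l) auto
  from lift_T[OF this vector_space_fscale]
  show "Vector_Spaces.linear fscale fscale (deconcat s)" and "w \<noteq> [] \<Longrightarrow> deconcat s (pure s w) =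
      (\<Sum>i\<in>{1..<length w}. pure2 (bar_T s) (bar_T s) (pure s (take i w)) (pure s (drop i w)))"
    by (auto simp: deconcat_def)
qed

lemma proj1_pure:
  assumes vs: "vector_space s"
  shows linear_proj1: "Vector_Spaces.linear fscale s (proj1 s)"
    and "w \<noteq> [] \<Longrightarrow> proj1 s (pure s w) = (if length w = 1 then hd w else 0)"
proof -
  interpret vector_space s by fact
  interpret p: vector_space_pair s s ..
  have "multilinear s s (\<lambda>w. if length w = 1 then hd w else 0)"
    unfolding multilinear_def
  proof (intro allI)
    fix xs ys
    show "Vector_Spaces.linear s s
      (\<lambda>v. if length (xs @ v # ys) = 1 then hd (xs @ v # ys) else 0)"
      by (cases "xs = [] \<and> ys = []") (auto simp: linear_ident p.linear_zero)
  qed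
  from lift_T[OF this vs]
  show "Vector_Spaces.linear fscale s (proj1 s)"
    and "w \<noteq> [] \<Longrightarrow> proj1 s (pure s w) = (if length w = 1 then hd w else 0)"
    by (auto simp: proj1_def)
qed

text \<open>Linear maps acting by a scalar on each homogeneous component exist; from these we get
  that the tensor product of maps with Koszul signs is well defined.\<close>

lemma graded_scaling_exists:
  fixes s :: "'k::field \<Rightarrow> 'v::ab_group_add \<Rightarrow> 'v"
  assumes gr: "graded_vector_space s gr"
  shows "\<exists>e. Vector_Spaces.linear s s e \<and> (\<forall>i. \<forall>v\<in>gr i. e v = s (\<sigma> i) v)"
proof -
  from gr interpret vector_space s by (simp add: graded_vector_space_def)
  have sub: "subspace (gr i)" for i using gr by (simp add: graded_vector_space_def)
  define P where "P v c \<longleftrightarrow> finite {i. c i \<noteq> 0} \<and> (\<forall>i. c i \<in> gr i) \<and> v = (\<Sum>i | c i \<noteq> 0. c i)"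
    for v and c :: "int \<Rightarrow> 'v"
  have ex1: "\<exists>!c. P v c" for v using gr by (simp add: graded_vector_space_def P_def)
  define C where "C v = (THE c. P v c)" for v
  have PC: "P v (C v)" for v unfolding C_def using ex1 by (rule theI')
  have C: "C v = c" if "P v c" for v c using ex1 PC that by blast
  have big: "(\<Sum>i | c i \<noteq> 0. s (\<tau> i) (c i)) = (\<Sum>i\<in>S. s (\<tau> i) (c i))"
    if "finite S" "{i. c i \<noteq> 0} \<subseteq> S" for c :: "int \<Rightarrow> 'v" and S \<tau>
    by (rule sum.mono_neutral_left) (use that in auto)
  have big1: "(\<Sum>i | c i \<noteq> 0. c i) = (\<Sum>i\<in>S. c i)"
    if "finite S" "{i. c i \<noteq> 0} \<subseteq> S" for c :: "int \<Rightarrow> 'v" and S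
    by (rule sum.mono_neutral_left) (use that in auto)
  have Cadd: "C (u + v) = (\<lambda>i. C u i + C v i)" for u v
  proof (rule C)
    let ?S = "{i. C u i \<noteq> 0} \<union> {i. C v i \<noteq> 0}"
    have fin: "finite ?S" using PC[of u] PC[of v] by (auto simp: P_def)
    have sb: "{i. C u i + C v i \<noteq> 0} \<subseteq> ?S" by auto
    have "u = (\<Sum>i\<in>?S. C u i)" "v = (\<Sum>i\<in>?S. C v i)"
      using PC[of u] PC[of v] big1[OF fin, of "C u"] big1[OF fin, of "C v"] by (auto simp: P_def)
    then have "u + v = (\<Sum>i\<in>?S. C u i + C v i)" by (simp add: sum.distrib)
    then show "P (u + v) (\<lambda>i. C u i + C v i)"
      using PC[of u] PC[of v] big1[OF fin sb] finite_subset[OF sb fin] sub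
      by (auto simp: P_def intro: subspace_add)
  qed
  have Cscale: "C (s a v) = (\<lambda>i. s a (C v i))" for a v
  proof (rule C)
    let ?S = "{i. C v i \<noteq> 0}"
    have fin: "finite ?S" using PC[of v] by (auto simp: P_def)
    have sb: "{i. s a (C v i) \<noteq> 0} \<subseteq> ?S" by auto
    have "s a v = s a (\<Sum>i\<in>?S. C v i)" using PC[of v] by (auto simp: P_def)
    then have "s a v = (\<Sum>i\<in>?S. s a (C v i))" by (simp add: scale_sum_right)
    then show "P (s a v) (\<lambda>i. s a (C v i))"
      using PC[of v] big1[OF fin sb] finite_subset[OF sb fin] sub
      by (auto simp: P_def intro: subspace_scale)
  qed
  define e where "e v = (\<Sum>i | C v i \<noteq> 0. s (\<sigma> i) (C v i))" for v
  have "e (u + v) = e u + e v" for u v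
  proof -
    let ?S = "{i. C u i \<noteq> 0} \<union> {i. C v i \<noteq> 0}"
    have fin: "finite ?S" using PC[of u] PC[of v] by (auto simp: P_def)
    have sb: "{i. C u i + C v i \<noteq> 0} \<subseteq> ?S" by auto
    show ?thesis
      unfolding e_def Cadd big[OF fin sb]
      using big[OF fin, of "C u" \<sigma>] big[OF fin, of "C v" \<sigma>]
      by (simp add: scale_right_distrib sum.distrib)
  qed
  moreover have "e (s a v) = s a (e v)" for a v
  proof -
    let ?S = "{i. C v i \<noteq> 0}"
    have fin: "finite ?S" using PC[of v] by (auto simp: P_def)
    have sb: "{i. s a (C v i) \<noteq> 0} \<subseteq> ?S" by auto
    show ?thesis
      unfolding e_def Cscale big[OF fin sb] by (simp add: scale_sum_right mult.commute)
  qed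
  ultimately have "Vector_Spaces.linear s s e"
    using vector_space_axioms by (auto simp: Vector_Spaces.linear_iff)
  moreover have "e v = s (\<sigma> i) v" if v: "v \<in> gr i" for i v
  proof -
    have sb: "{j. (if j = i then v else 0) \<noteq> 0} \<subseteq> {i}" by auto
    have Cv: "C v = (\<lambda>j. if j = i then v else 0)"
    proof (rule C)
      show "P v (\<lambda>j. if j = i then v else 0)"
        using v sub big1[OF _ sb] finite_subset[OF sb] by (auto simp: P_def intro: subspace_0)
    qed
    show ?thesis unfolding e_def Cv using big[OF _ sb, of \<sigma>] by simp
  qed
  ultimately show ?thesis by blast
qed

lemma koszul_sign_add: "koszul_sign (m + n) = koszul_sign m * koszul_sign n"
  by (auto simp: koszul_sign_def)

lemma tensor_map_pure2:
  assumes gr: "graded_vector_space s gr"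
    and f: "linear_on fscale fscale (bar_T s) (bar_T s') f"
    and g: "linear_on fscale fscale (bar_T s) (bar_T s') g"
  shows linear_on_tensor_map: "linear_on fscale fscale (tensor (bar_T s) (bar_T s))
      (tensor (bar_T s') (bar_T s')) (tensor_map s gr s' f p g)"
    and "a \<in> bar_T_deg s gr d \<Longrightarrow> b \<in> bar_T s \<Longrightarrow>
      tensor_map s gr s' f p g (pure2 (bar_T s) (bar_T s) a b) =
      fscale (koszul_sign (p * d)) (pure2 (bar_T s') (bar_T s') (f a) (g b))"
proof -
  let ?T = "bar_T s" and ?T' = "bar_T s'"
  from gr have vs: "vector_space s" by (simp add: graded_vector_space_def)
  interpret vector_space s by fact
  obtain e where e: "Vector_Spaces.linear s s e" "\<And>i v. v \<in> gr i \<Longrightarrow> e v = s (koszul_sign (p * i)) v"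
    using graded_scaling_exists[OF gr, of "\<lambda>i. koszul_sign (p * i)"] by auto
  have ml: "Vector_Spaces.linear s fscale (\<lambda>v. pure s (xs @ v # ys))" for xs ys
    using multilinear_pure[OF vs] by (auto simp: multilinear_def)
  have "Vector_Spaces.linear s fscale (\<lambda>v. pure s (map e (xs @ v # ys)))" for xs ys
    using Vector_Spaces.linear_compose[OF e(1) ml[of "map e xs" "map e ys"]] by (simp add: comp_def)
  then have "multilinear s fscale (\<lambda>w. pure s (map e w))" by (simp add: multilinear_def)
  note E = lift_T[OF this vector_space_fscale]
  define E where "E = lift_T s fscale (\<lambda>w. pure s (map e w))"
  interpret E: Vector_Spaces.linear fscale fscale E using E(1) by (simp add: E_def)
  have E_pure: "E (pure s w) = pure s (map e w)" if "w \<noteq> []" for w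
    using E(2)[OF that] by (simp add: E_def)
  have subT: "fs.subspace ?T" by (simp add: bar_T_def)
  have E_T: "E t \<in> ?T" if "t \<in> ?T" for t
  proof -
    from that have "t \<in> fs.span (pure s ` {w. w \<noteq> []})" by (simp add: bar_T_def)
    then show ?thesis
    proof (induction rule: fs.span_induct_alt)
      case base show ?case unfolding E.zero by (rule fs.subspace_0[OF subT])
    next
      case (step c x y)
      then show ?case
        by (auto simp del: zero_fun_apply plus_fun_apply fscale_apply simp: E.add E.scale E_pure intro!: fs.subspace_add[OF subT] fs.subspace_scale[OF subT] pure_in_bar_T)
    qed
  qed
  have sgn: "pure s (zs @ map e w) = fscale (koszul_sign (p * sum_list ds)) (pure s (zs @ w))"
    if "list_all2 (\<lambda>v e. v \<in> gr e) w ds" for zs w ds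
    using that
  proof (induction arbitrary: zs rule: list_all2_induct)
    case Nil
    then show ?case by (simp add: koszul_sign_def)
  next
    case (Cons v w d ds)
    have "pure s (zs @ map e (v # w)) = pure s (zs @ s (koszul_sign (p * d)) v # map e w)"
      using Cons e(2) by simp
    also have "\<dots> = fscale (koszul_sign (p * d)) (pure s (zs @ v # map e w))"
      using ml[of zs "map e w"] by (simp add: Vector_Spaces.linear_iff)
    also have "\<dots> = fscale (koszul_sign (p * d)) (pure s ((zs @ [v]) @ map e w))" by simp
    also have "\<dots> = fscale (koszul_sign (p * d))
        (fscale (koszul_sign (p * sum_list ds)) (pure s ((zs @ [v]) @ w)))"
      by (simp only: Cons.IH)
    finally show ?case by (simp add: koszul_sign_add distrib_left)
  qed
  have E_deg: "a \<in> ?T \<and> E a = fscale (koszul_sign (p * d)) a" if "a \<in> bar_T_deg s gr d" for a d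
    using that unfolding bar_T_deg_def
  proof (induction rule: fs.span_induct_alt)
    case base show ?case unfolding E.zero using fs.subspace_0[OF subT] by (simp only: fs.scale_zero_right)
  next
    case (step c x y)
    then obtain w ds where w: "x = pure s w" "w \<noteq> []" "list_all2 (\<lambda>v e. v \<in> gr e) w ds" "sum_list ds = d"
      by auto
    have "E x = fscale (koszul_sign (p * d)) x" using sgn[OF w(3), of "[]"] w E_pure by simp
    moreover have "x \<in> ?T" using w by (auto intro: pure_in_bar_T)
    ultimately show ?case using step(2)
      by (auto simp del: zero_fun_apply plus_fun_apply fscale_apply simp: E.add E.scale fs.scale_right_distrib mult.commute
          intro!: fs.subspace_add[OF subT] fs.subspace_scale[OF subT])
  qed
  have "bilinear_on ?T ?T fscale (\<lambda>(a, b). pure2 ?T' ?T' (f (E a)) (g b))"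
    using bilinear_on_pure2[of ?T' ?T'] f g E_T
    by (auto simp: bilinear_on_def linear_on_def E.add E.scale)
  from tensor_universal[OF this vector_space_fscale] obtain h where
    h: "Vector_Spaces.linear fscale fscale h"
      "\<And>a b. a \<in> ?T \<Longrightarrow> b \<in> ?T \<Longrightarrow> h (pure2 ?T ?T a b) = pure2 ?T' ?T' (f (E a)) (g b)"
    by auto
  interpret h: Vector_Spaces.linear fscale fscale h by fact
  have subTT: "fs.subspace (tensor ?T' ?T')" by (simp add: tensor_def)
  have "h t \<in> tensor ?T' ?T'" if "t \<in> tensor ?T ?T" for t
  proof -
    from that have "t \<in> fs.span {pure2 ?T ?T a b |a b. a \<in> ?T \<and> b \<in> ?T}" by (simp add: tensor_def)
    then show ?thesis
    proof (induction rule: fs.span_induct_alt)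
      case base show ?case unfolding h.zero by (rule fs.subspace_0[OF subTT])
    next
      case (step c x y)
      then obtain a b where ab: "x = pure2 ?T ?T a b" "a \<in> ?T" "b \<in> ?T" by auto
      have "f (E a) \<in> ?T'" "g b \<in> ?T'" using ab E_T f g by (auto simp: linear_on_def)
      then have "h x \<in> tensor ?T' ?T'"
        using ab h(2) unfolding tensor_def by (auto intro: fs.span_base)
      then show ?case using step
        by (auto simp del: zero_fun_apply plus_fun_apply fscale_apply simp: h.add h.scale intro!: fs.subspace_add[OF subTT] fs.subspace_scale[OF subTT])
    qed
  qed
  then have h1: "linear_on fscale fscale (tensor ?T ?T) (tensor ?T' ?T') h"
    by (auto simp: linear_on_def h.add h.scale)
  have h2: "h (pure2 ?T ?T a b) = fscale (koszul_sign (p * d)) (pure2 ?T' ?T' (f a) (g b))"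
    if "a \<in> bar_T_deg s gr d" "b \<in> ?T" for a b d
  proof -
    have "f a \<in> ?T'" "g b \<in> ?T'" "f (E a) = fscale (koszul_sign (p * d)) (f a)"
      using E_deg[OF that(1)] that(2) f g by (auto simp: linear_on_def)
    then show ?thesis
      using h(2)[of a b] E_deg[OF that(1)] that(2) bilinear_on_pure2[of ?T' ?T']
      by (auto simp: bilinear_on_def linear_on_def)
  qed
  have "\<exists>h. linear_on fscale fscale (tensor ?T ?T) (tensor ?T' ?T') h \<and>
    (\<forall>d. \<forall>a \<in> bar_T_deg s gr d. \<forall>b \<in> ?T.
      h (pure2 ?T ?T a b) = fscale (koszul_sign (p * d)) (pure2 ?T' ?T' (f a) (g b)))"
    using h1 h2 by blast
  from someI_ex[OF this]
  show "linear_on fscale fscale (tensor ?T ?T) (tensor ?T' ?T') (tensor_map s gr s' f p g)"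
    and "a \<in> bar_T_deg s gr d \<Longrightarrow> b \<in> bar_T s \<Longrightarrow>
      tensor_map s gr s' f p g (pure2 ?T ?T a b) =
      fscale (koszul_sign (p * d)) (pure2 ?T' ?T' (f a) (g b))"
    unfolding tensor_map_def by blast+
qed

lemma graded_vector_space_suspension:
  fixes s :: "'k::field \<Rightarrow> 'v::ab_group_add \<Rightarrow> 'v"
  assumes "graded_vector_space s gr"
  shows "graded_vector_space s (suspension gr)"
proof -
  define P where "P g v c \<longleftrightarrow> finite {i. c i \<noteq> 0} \<and> (\<forall>i. c i \<in> g i) \<and> v = (\<Sum>i | c i \<noteq> 0. c i)"
    for g and v and c :: "int \<Rightarrow> 'v"
  have shift: "P g' v c" if P: "P g v (\<lambda>i. c (i + k))" and g: "\<And>i. g' (i + k) = g i" for g g' v c k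
  proof -
    have bij: "bij_betw (\<lambda>i. i + k) {i. c (i + k) \<noteq> 0} {i. c i \<noteq> 0}"
      by (rule bij_betw_byWitness[where f'="\<lambda>i. i - k"]) auto
    have "c i \<in> g' i" for i
    proof -
      have "c (i - k + k) \<in> g (i - k)" using P unfolding P_def by blast
      then show ?thesis using g[of "i - k"] by simp
    qed
    moreover have "finite {i. c i \<noteq> 0}"
      using P bij_betw_finite[OF bij] unfolding P_def by blast
    moreover have "v = (\<Sum>i | c i \<noteq> 0. c i)"
      using P sum.reindex_bij_betw[OF bij, of c] unfolding P_def by metis
    ultimately show ?thesis unfolding P_def by blast
  qed
  have "\<exists>!c. P (suspension gr) v c" for v
  proof -
    have "\<exists>!c. P gr v c" using assms unfolding graded_vector_space_def P_def by blast
    then obtain c where c: "P gr v c" "\<And>c'. P gr v c' \<Longrightarrow> c' = c" by blast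
    show ?thesis
    proof (rule ex1I[of _ "\<lambda>i. c (i + 1)"])
      show "P (suspension gr) v (\<lambda>i. c (i + 1))"
        by (rule shift[of gr _ _ "-1"]) (use c(1) in \<open>simp_all add: suspension_def\<close>)
    next
      fix c' assume "P (suspension gr) v c'"
      then have *: "P (suspension gr) v (\<lambda>i. c' (i + 1 - 1))" by simp
      have "P gr v (\<lambda>i. c' (i - 1))"
        by (rule shift[OF *]) (simp add: suspension_def)
      from c(2)[OF this] have "c' (i + 1 - 1) = c (i + 1)" for i by metis
      then show "c' = (\<lambda>i. c (i + 1))" by (intro ext) simp
    qed
  qed
  moreover have "\<forall>i. module.subspace s (suspension gr i)" "vector_space s"
    using assms by (auto simp: graded_vector_space_def suspension_def)
  ultimately show ?thesis unfolding graded_vector_space_def P_def by blast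
qed

end

theory Submission
  imports Defs
begin

text \<open>
  A tensor is recovered from its component of exponent one and its coproduct:
  \<open>t = proj1 t + \<mu> (\<Delta> t)\<close>, where \<open>\<mu>\<close> sends \<open>a \<otimes> b\<close> to the tensor obtained by putting \<open>proj1 a\<close> in
  front of \<open>b\<close> (\<open>deconcat_reconstruction\<close>). Hence a coalgebra morphism \<open>F\<close> and a coderivation \<open>Q\<close>
  are computed recursively from their Taylor coefficients. In particular, if the Taylor coefficients
  of two coalgebra morphisms agree in arities below \<open>n\<close>, then the morphisms agree on a pure tensor
  of exponent \<open>n\<close> as soon as their \<open>n\<close>-th coefficients agree there
  (\<open>coalgebra_morphism_eq_pure\<close>); and, for homogeneous \<open>x\<close>,
  \<open>Q (x \<otimes> ws) = Q\<^sub>1 x \<otimes> ws \<plusminus> x \<otimes> Q ws\<close> up to tensors of smaller exponent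
  (\<open>coderivation_pure_Cons\<close>).

  The Taylor coefficients of \<open>G\<close> and \<open>G'\<close> are compared by induction on the arity \<open>n\<close>. The first
  argument is a sum of an element of \<open>X\<close>, where they agree by hypothesis, and of some \<open>Q\<^sub>1 x\<close> with
  \<open>x \<in> X\<close>; by linearity \<open>x\<close> may be taken homogeneous. For such an \<open>x\<close>, the morphisms agree on
  \<open>t = x \<otimes> ws\<close>, because an argument of \<open>t\<close> lies in \<open>X\<close>. Since they commute with the differentials,
  \<open>G (Q t) = R (G t) = R (G' t) = G' (Q t)\<close>. In \<open>Q t\<close>, they agree on the tensors of smaller exponent by
  the induction hypothesis, and on \<open>x \<otimes> Q ws\<close> because its first argument is again \<open>x\<close>. So they agree
  on the one remaining summand \<open>Q\<^sub>1 x \<otimes> ws\<close> (\<open>taylor_eq_on_differentials\<close>).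
\<close>

section \<open>Linear maps on tensor spaces\<close>

lemma linear_on_sum:
  assumes "vector_space s1" "vector_space s2"
    and f: "linear_on s1 s2 A B f" and A: "module.subspace s1 A"
    and x: "\<And>i. i \<in> I \<Longrightarrow> x i \<in> A"
  shows "f (\<Sum>i\<in>I. x i) = (\<Sum>i\<in>I. f (x i))"
proof -
  interpret s1: vector_space s1 by fact
  interpret s2: vector_space s2 by fact
  have "f (s1 0 0) = s2 0 (f 0)"
    using f s1.subspace_0[OF A] unfolding linear_on_def by blast
  then have f0: "f 0 = 0" by (simp only: s1.scale_zero_left s2.scale_zero_left)
  show ?thesis using x
  proof (induction I rule: infinite_finite_induct)
    case (insert i I)
    then have "f (x i + (\<Sum>i\<in>I. x i)) = f (x i) + f (\<Sum>i\<in>I. x i)"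
      using f s1.subspace_sum[OF A, of I x] unfolding linear_on_def by blast
    then show ?case using insert by simp
  qed (simp_all only: sum.infinite sum.empty f0 not_False_eq_True)
qed

lemma linear_at_0:
  assumes "Vector_Spaces.linear s s' f"
  shows "f 0 = 0"
proof -
  interpret Vector_Spaces.linear s s' f by fact
  show ?thesis by (rule zero)
qed

lemma subspace_bar_T: "fs.subspace (bar_T s)"
  by (simp add: bar_T_def)

lemma pure2_in_tensor: "a \<in> A \<Longrightarrow> b \<in> B \<Longrightarrow> pure2 A B a b \<in> tensor A B"
  unfolding tensor_def by (rule fs.span_base) blast

lemma linear_on_pure2_left:
  assumes f: "linear_on fscale s' (tensor A B) C f" and b: "b \<in> B"
  shows "linear_on fscale s' A UNIV (\<lambda>a. f (pure2 A B a b))"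
  using f bilinear_on_pure2[of A B] b pure2_in_tensor[OF _ b, of _ A]
  unfolding linear_on_def bilinear_on_def by simp

lemma linear_on_subset: "linear_on s s' A B f \<Longrightarrow> A' \<subseteq> A \<Longrightarrow> linear_on s s' A' B f"
  unfolding linear_on_def by blast

lemma linear_pure:
  assumes "vector_space s"
  shows "Vector_Spaces.linear s fscale (\<lambda>v. pure s (xs @ v # ys))"
  using multilinear_pure[OF assms] by (simp add: multilinear_def)

lemma linear_taylor:
  assumes V: "vector_space sV" and W: "vector_space sW"
    and F: "linear_on fscale fscale (bar_T sV) (bar_T sW) F"
  shows "Vector_Spaces.linear sV sW (\<lambda>v. taylor sV sW F (xs @ v # ys))"
proof -
  have "pure sV (xs @ v # ys) \<in> bar_T sV" for v by (rule pure_in_bar_T) simp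
  then show ?thesis
    using F linear_pure[OF V, of xs ys] linear_proj1[OF W] V W
    unfolding Vector_Spaces.linear_iff linear_on_def taylor_def by simp
qed

section \<open>Reconstruction of a tensor from its coproduct\<close>

definition cons_tensor ::
  "('k::field \<Rightarrow> 'v::ab_group_add \<Rightarrow> 'v) \<Rightarrow> 'v \<Rightarrow> ('v, 'k) tens \<Rightarrow> ('v, 'k) tens"
where
  "cons_tensor s v = lift_T s fscale (\<lambda>w. pure s (v # w))"

lemma cons_tensor:
  assumes vs: "vector_space s"
  shows linear_cons_tensor: "Vector_Spaces.linear fscale fscale (cons_tensor s v)"
    and cons_tensor_pure: "w \<noteq> [] \<Longrightarrow> cons_tensor s v (pure s w) = pure s (v # w)"
proof -
  have "multilinear s fscale (\<lambda>w. pure s (v # w))"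
    using linear_pure[OF vs, of "v # xs" ys for xs ys] by (simp add: multilinear_def)
  from lift_T[OF this vector_space_fscale]
  show "Vector_Spaces.linear fscale fscale (cons_tensor s v)"
    and "w \<noteq> [] \<Longrightarrow> cons_tensor s v (pure s w) = pure s (v # w)"
    by (simp_all add: cons_tensor_def)
qed

lemma linear_imp_linear_on: "Vector_Spaces.linear s s' f \<Longrightarrow> linear_on s s' A UNIV f"
  by (simp add: linear_on_def Vector_Spaces.linear_iff)

lemma linear_fscale_add:
  assumes "Vector_Spaces.linear fscale fscale f" and "Vector_Spaces.linear fscale fscale g"
  shows "Vector_Spaces.linear fscale fscale (\<lambda>t. f t + g t)"
proof -
  interpret p: vector_space_pair fscale fscale ..
  show ?thesis by (rule p.linear_compose_add[OF assms])
qed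

lemma linear_fscale_scale:
  assumes "Vector_Spaces.linear fscale fscale f"
  shows "Vector_Spaces.linear fscale fscale (\<lambda>t. fscale c (f t))"
proof -
  interpret p: vector_space_pair fscale fscale ..
  show ?thesis by (rule p.linear_compose_scale_right[OF assms])
qed

text \<open>Linearity in \<open>v\<close> holds on \<open>bar_T s\<close> only: the value of \<open>cons_tensor s v\<close> at other functions is an
  arbitrary choice made for each \<open>v\<close> separately.\<close>

lemma linear_cons_tensor_left:
  assumes vs: "vector_space s" and b: "b \<in> bar_T s"
  shows "Vector_Spaces.linear s fscale (\<lambda>v. cons_tensor s v b)"
proof -
  interpret vector_space s by fact
  note lin = linear_cons_tensor[OF vs]
  have head: "Vector_Spaces.linear s fscale (\<lambda>v. pure s (v # w))" for w
    using linear_pure[OF vs, of "[]"] by simp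
  have add: "pure s ((u + v) # w) = pure s (u # w) + pure s (v # w)"
    and scale: "pure s (s c v # w) = fscale c (pure s (v # w))" for u v w c
    using head unfolding Vector_Spaces.linear_iff by blast+
  have "cons_tensor s (u + v) b = cons_tensor s u b + cons_tensor s v b" for u v
    by (rule linear_on_eq_bar_T[OF linear_imp_linear_on[OF lin]
          linear_imp_linear_on[OF linear_fscale_add[OF lin lin]] _ vector_space_fscale b])
      (simp only: cons_tensor_pure[OF vs] add simp_thms)
  moreover have "cons_tensor s (s c v) b = fscale c (cons_tensor s v b)" for c v
    by (rule linear_on_eq_bar_T[OF linear_imp_linear_on[OF lin]
          linear_imp_linear_on[OF linear_fscale_scale[OF lin]] _ vector_space_fscale b])
      (simp only: cons_tensor_pure[OF vs] scale simp_thms)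
  ultimately show ?thesis
    using vector_space_axioms vector_space_fscale by (auto simp: Vector_Spaces.linear_iff)
qed

text \<open>The map \<open>a \<otimes> b \<mapsto> proj1 a \<otimes> b\<close>; it kills \<open>a \<otimes> b\<close> unless \<open>a\<close> has a component
  of exponent one, and otherwise undoes the cut after that component.\<close>

definition concat_head ::
  "('k::field \<Rightarrow> 'v::ab_group_add \<Rightarrow> 'v) \<Rightarrow> (('v, 'k) tens, ('v, 'k) tens, 'k) tens2 \<Rightarrow> ('v, 'k) tens"
where
  "concat_head s = (SOME f. Vector_Spaces.linear fscale fscale f \<and>
     (\<forall>a\<in>bar_T s. \<forall>b\<in>bar_T s.
        f (pure2 (bar_T s) (bar_T s) a b) = cons_tensor s (proj1 s a) b))"

lemma concat_head:
  assumes vs: "vector_space s"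
  shows linear_concat_head: "Vector_Spaces.linear fscale fscale (concat_head s)"
    and concat_head_pure2: "a \<in> bar_T s \<Longrightarrow> b \<in> bar_T s \<Longrightarrow>
      concat_head s (pure2 (bar_T s) (bar_T s) a b) = cons_tensor s (proj1 s a) b"
proof -
  have "bilinear_on (bar_T s) (bar_T s) fscale (\<lambda>(a, b). cons_tensor s (proj1 s a) b)"
    using linear_cons_tensor[OF vs] linear_cons_tensor_left[OF vs] linear_proj1[OF vs]
    by (simp add: bilinear_on_def linear_on_def Vector_Spaces.linear_iff)
  from tensor_universal[OF this vector_space_fscale]
  have "\<exists>f. Vector_Spaces.linear fscale fscale f \<and>
     (\<forall>a\<in>bar_T s. \<forall>b\<in>bar_T s.
        f (pure2 (bar_T s) (bar_T s) a b) = cons_tensor s (proj1 s a) b)"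
    by (simp only: prod.case)
  note * = someI_ex[OF this, folded concat_head_def]
  show "Vector_Spaces.linear fscale fscale (concat_head s)"
    and "a \<in> bar_T s \<Longrightarrow> b \<in> bar_T s \<Longrightarrow>
      concat_head s (pure2 (bar_T s) (bar_T s) a b) = cons_tensor s (proj1 s a) b"
    using * by simp_all
qed

text \<open>Among the cuts of \<open>v\<^sub>1 \<otimes> \<cdots> \<otimes> v\<^sub>n\<close>, only the one after \<open>v\<^sub>1\<close> survives \<open>concat_head\<close>, and gluing
  its two pieces gives back the tensor. There is no cut if \<open>n = 1\<close>; then \<open>proj1\<close> takes over.\<close>

lemma deconcat_reconstruction:
  assumes vs: "vector_space s" and t: "t \<in> bar_T s"
  shows "t = pure s [proj1 s t] + concat_head s (deconcat s t)"
proof -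
  let ?T = "bar_T s"
  note \<mu> = concat_head[OF vs]
  interpret \<mu>: Vector_Spaces.linear fscale fscale "concat_head s" by (rule \<mu>(1))
  have pure1: "Vector_Spaces.linear s fscale (\<lambda>v. pure s [v])"
    using linear_pure[OF vs, of "[]" "[]"] by simp
  have head: "cons_tensor s 0 b = 0" if "b \<in> ?T" for b
    using linear_at_0[OF linear_cons_tensor_left[OF vs that]] .
  have lin: "Vector_Spaces.linear fscale fscale (\<lambda>t. pure s [proj1 s t] + concat_head s (deconcat s t))"
    by (rule linear_fscale_add)
      (use Vector_Spaces.linear_compose[OF linear_proj1[OF vs] pure1]
          Vector_Spaces.linear_compose[OF linear_deconcat[OF vs] \<mu>(1)] in \<open>simp_all add: comp_def\<close>)
  have "pure s w = pure s [proj1 s (pure s w)] + concat_head s (deconcat s (pure s w))" if "w \<noteq> []" for w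
  proof -
    have "concat_head s (deconcat s (pure s w)) =
        (\<Sum>i\<in>{1..<length w}. concat_head s (pure2 ?T ?T (pure s (take i w)) (pure s (drop i w))))"
      using deconcat_pure(2)[OF vs that] by (simp add: \<mu>.sum)
    also have "\<dots> = (\<Sum>i\<in>{1..<length w}. if i = 1 then pure s w else 0)"
    proof (rule sum.cong)
      fix i assume i: "i \<in> {1..<length w}"
      then have ne: "take i w \<noteq> []" "drop i w \<noteq> []" by auto
      have "concat_head s (pure2 ?T ?T (pure s (take i w)) (pure s (drop i w))) =
          cons_tensor s (if i = 1 then hd w else 0) (pure s (drop i w))"
        using i \<mu>(2)[OF pure_in_bar_T[OF ne(1)] pure_in_bar_T[OF ne(2)]]
          proj1_pure(2)[OF vs ne(1)] by (simp add: hd_take)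
      also have "\<dots> = (if i = 1 then pure s w else 0)"
        using head[OF pure_in_bar_T[OF ne(2)]] cons_tensor_pure[OF vs ne(2), of "hd w"] that
        by (auto simp: drop_Suc)
      finally show "concat_head s (pure2 ?T ?T (pure s (take i w)) (pure s (drop i w))) =
          (if i = 1 then pure s w else 0)" .
    qed simp
    also have "\<dots> = (if length w = 1 then 0 else pure s w)"
      using that by (subst sum.delta) (auto simp: Suc_lessI)
    finally have *: "concat_head s (deconcat s (pure s w)) = (if length w = 1 then 0 else pure s w)" .
    show ?thesis
    proof (cases "length w = 1")
      case True
      then have "[hd w] = w" by (cases w) auto
      then show ?thesis unfolding * using True proj1_pure(2)[OF vs that] by simp
    next
      case False
      then show ?thesis
        unfolding * using proj1_pure(2)[OF vs that] linear_at_0[OF pure1] by simp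
    qed
  qed
  then show ?thesis
    using linear_on_eq_bar_T[OF linear_imp_linear_on[OF fs.linear_ident]
        linear_imp_linear_on[OF lin] _ vector_space_fscale t] by simp
qed

section \<open>Homogeneous tensors\<close>

lemma graded_span:
  assumes "graded_vector_space s gr"
  shows "v \<in> module.span s (\<Union>i. gr i)"
proof -
  interpret vector_space s using assms by (simp add: graded_vector_space_def)
  obtain c where c: "\<forall>i. c i \<in> gr i" "v = (\<Sum>i | c i \<noteq> 0. c i)"
    using assms unfolding graded_vector_space_def by blast
  have "(\<Sum>i | c i \<noteq> 0. c i) \<in> span (\<Union>i. gr i)"
    by (rule span_sum) (use c(1) in \<open>auto intro: span_base\<close>)
  then show ?thesis using c(2) by metis
qed

definition homogeneous_list :: "(int \<Rightarrow> 'v set) \<Rightarrow> 'v list \<Rightarrow> bool" where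
  "homogeneous_list gr w \<longleftrightarrow> (\<exists>ds. list_all2 (\<lambda>v e. v \<in> gr e) w ds)"

text \<open>The prefix \<open>us\<close> serves the induction: it collects the factors that have not been decomposed, in
  front of those that have.\<close>

lemma pure_in_span_homogeneous:
  assumes gr: "graded_vector_space s gr"
  shows "pure s (us @ w) \<in>
    fs.span {pure s (us @ w') | w'. homogeneous_list gr w' \<and> length w' = length w}"
proof (induction w arbitrary: us)
  case Nil
  have "homogeneous_list gr []" unfolding homogeneous_list_def by (rule exI[of _ "[]"]) simp
  then show ?case by (intro fs.span_base) auto
next
  case (Cons v w)
  let ?S = "{pure s (us @ w') | w'. homogeneous_list gr w' \<and> length w' = length (v # w)}"
  have vs: "vector_space s" using gr by (simp add: graded_vector_space_def)
  have "pure s ((us @ [v]) @ w') \<in> fs.span ?S"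
    if w': "homogeneous_list gr w'" "length w' = length w" for w'
  proof -
    interpret l: Vector_Spaces.linear s fscale "\<lambda>v. pure s (us @ v # w')"
      by (rule linear_pure[OF vs])
    have "pure s (us @ u # w') \<in> ?S" if "u \<in> gr i" for u i
    proof -
      obtain ds where "list_all2 (\<lambda>v e. v \<in> gr e) w' ds"
        using w'(1) unfolding homogeneous_list_def by blast
      then have "list_all2 (\<lambda>v e. v \<in> gr e) (u # w') (i # ds)" using that by simp
      then have "homogeneous_list gr (u # w')" unfolding homogeneous_list_def by blast
      then show ?thesis using w'(2) by force
    qed
    then have "(\<lambda>v. pure s (us @ v # w')) ` (\<Union>i. gr i) \<subseteq> ?S" by blast
    then have "fs.span ((\<lambda>v. pure s (us @ v # w')) ` (\<Union>i. gr i)) \<subseteq> fs.span ?S"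
      by (rule fs.span_mono)
    then show ?thesis using graded_span[OF gr, of v] unfolding l.span_image by auto
  qed
  then have "{pure s ((us @ [v]) @ w') | w'. homogeneous_list gr w' \<and> length w' = length w}
      \<subseteq> fs.span ?S" by blast
  then have "fs.span {pure s ((us @ [v]) @ w') | w'. homogeneous_list gr w' \<and> length w' = length w}
      \<subseteq> fs.span ?S" by (rule fs.span_minimal) simp
  then show ?case using Cons.IH[of "us @ [v]"] by (auto simp only: append_assoc append.simps)
qed

lemma pure_in_bar_T_deg:
  assumes "homogeneous_list gr w" "w \<noteq> []"
  obtains d where "pure s w \<in> bar_T_deg s gr d"
  using assms unfolding homogeneous_list_def bar_T_deg_def by (blast intro: fs.span_base)

text \<open>The Koszul sign in \<open>tensor_map\<close> refers to homogeneous tensors. This lemma carries identities over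
  to all pure tensors without changing their exponent, on which the value of \<open>proj1\<close> depends.\<close>

lemma linear_on_eq_homogeneous:
  assumes gr: "graded_vector_space s gr"
    and f: "linear_on fscale s' (bar_T s) B f" and g: "linear_on fscale s' (bar_T s) B' g"
    and vs': "vector_space s'"
    and eq: "\<And>w' d. w' \<noteq> [] \<Longrightarrow> length w' = length w \<Longrightarrow> pure s w' \<in> bar_T_deg s gr d \<Longrightarrow>
               f (pure s w') = g (pure s w')"
    and w: "w \<noteq> []"
  shows "f (pure s w) = g (pure s w)"
proof -
  let ?S = "{pure s w' | w'. homogeneous_list gr w' \<and> length w' = length w}"
  have "?S \<subseteq> bar_T s" using w by (fastforce intro: pure_in_bar_T)
  then have sub: "fs.span ?S \<subseteq> bar_T s" by (rule fs.span_minimal[OF _ subspace_bar_T])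
  have "pure s w \<in> fs.span ?S" using pure_in_span_homogeneous[OF gr, of "[]" w] by simp
  moreover have "f x = g x" if x: "x \<in> ?S" for x
  proof -
    obtain w' where w': "x = pure s w'" "homogeneous_list gr w'" "length w' = length w"
      using x by blast
    then have "w' \<noteq> []" using w by auto
    then obtain d where "pure s w' \<in> bar_T_deg s gr d" using pure_in_bar_T_deg[OF w'(2)] by blast
    then show ?thesis using eq w' \<open>w' \<noteq> []\<close> by blast
  qed
  ultimately show ?thesis
    using linear_on_eq_span[OF linear_on_subset[OF f sub] linear_on_subset[OF g sub] _ _ vs']
    by blast
qed

text \<open>No sign arises when the second map has degree 0, so the formula extends by linearity from
  homogeneous first factors to arbitrary ones.\<close>

lemma tensor_map_degree_0:
  assumes gr: "graded_vector_space s gr"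
    and f: "linear_on fscale fscale (bar_T s) (bar_T s') f"
    and g: "linear_on fscale fscale (bar_T s) (bar_T s') g"
    and w: "w \<noteq> []" and b: "b \<in> bar_T s"
  shows "tensor_map s gr s' f 0 g (pure2 (bar_T s) (bar_T s) (pure s w) b) =
         pure2 (bar_T s') (bar_T s') (f (pure s w)) (g b)"
proof (rule linear_on_eq_homogeneous[OF gr _ _ vector_space_fscale _ w])
  show "linear_on fscale fscale (bar_T s) UNIV
      (\<lambda>a. tensor_map s gr s' f 0 g (pure2 (bar_T s) (bar_T s) a b))"
    by (rule linear_on_pure2_left[OF linear_on_tensor_map[OF gr f g] b])
  show "linear_on fscale fscale (bar_T s) UNIV (\<lambda>a. pure2 (bar_T s') (bar_T s') (f a) (g b))"
    using f g b bilinear_on_pure2[of "bar_T s'" "bar_T s'"]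
    by (simp add: linear_on_def bilinear_on_def)
qed (simp add: tensor_map_pure2(2)[OF gr f g _ b] koszul_sign_def)

section \<open>Recursion for coalgebra morphisms and coderivations\<close>

text \<open>The reconstruction formula for the tensor \<open>F w\<close>, with its coproduct expressed through \<open>F\<close>.\<close>

lemma coalgebra_morphism_pure:
  assumes gr: "graded_vector_space s gr" and W: "vector_space s'"
    and F: "linear_on fscale fscale (bar_T s) (bar_T s') F"
    and coalg: "\<And>t. t \<in> bar_T s \<Longrightarrow>
           deconcat s' (F t) = tensor_map s gr s' F 0 F (deconcat s t)"
    and w: "w \<noteq> []"
  shows "F (pure s w) = pure s' [taylor s s' F w] +
    (\<Sum>i\<in>{1..<length w}. cons_tensor s' (taylor s s' F (take i w)) (F (pure s (drop i w))))"
proof -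
  let ?T = "bar_T s" and ?T' = "bar_T s'"
  have V: "vector_space s" using gr by (simp add: graded_vector_space_def)
  have FT: "F t \<in> ?T'" if "t \<in> ?T" for t using F that by (simp add: linear_on_def)
  note \<mu> = concat_head[OF W] deconcat_reconstruction[OF W]
  interpret \<mu>: Vector_Spaces.linear fscale fscale "concat_head s'" by (rule \<mu>(1))
  have ne: "pure s (take i w) \<in> ?T" "pure s (drop i w) \<in> ?T" "take i w \<noteq> []"
    if "i \<in> {1..<length w}" for i
    using that by (auto intro: pure_in_bar_T)
  have "deconcat s' (F (pure s w)) = tensor_map s gr s' F 0 F
      (\<Sum>i\<in>{1..<length w}. pure2 ?T ?T (pure s (take i w)) (pure s (drop i w)))"
    using coalg[OF pure_in_bar_T[OF w]] deconcat_pure(2)[OF V w] by simp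
  also have "\<dots> = (\<Sum>i\<in>{1..<length w}.
      tensor_map s gr s' F 0 F (pure2 ?T ?T (pure s (take i w)) (pure s (drop i w))))"
    by (rule linear_on_sum[OF vector_space_fscale vector_space_fscale
          linear_on_tensor_map[OF gr F F]])
      (use ne in \<open>auto simp: tensor_def intro: pure2_in_tensor[unfolded tensor_def]\<close>)
  also have "\<dots> = (\<Sum>i\<in>{1..<length w}.
      pure2 ?T' ?T' (F (pure s (take i w))) (F (pure s (drop i w))))"
    by (rule sum.cong) (use tensor_map_degree_0[OF gr F F] ne in auto)
  finally have "concat_head s' (deconcat s' (F (pure s w))) = (\<Sum>i\<in>{1..<length w}.
      cons_tensor s' (taylor s s' F (take i w)) (F (pure s (drop i w))))"
    using ne FT by (simp add: \<mu>.sum \<mu>(2) taylor_def)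
  then show ?thesis using \<mu>(3)[OF FT[OF pure_in_bar_T[OF w]]] by (simp add: taylor_def)
qed

text \<open>A tensor of exponent one has coproduct zero, hence so does its image; such an image equals its own
  component of exponent one.\<close>

lemma coderivation_pure_single:
  assumes gr: "graded_vector_space s gr" and Q: "coderivation s gr p Q"
  shows "Q (pure s [x]) = pure s [taylor s s Q [x]]"
proof -
  let ?T = "bar_T s"
  have vs: "vector_space s" using gr by (simp add: graded_vector_space_def)
  have lQ: "linear_on fscale fscale ?T ?T Q"
    and cod: "\<And>t. t \<in> ?T \<Longrightarrow> deconcat s (Q t) =
        tensor_map s gr s Q 0 id (deconcat s t) + tensor_map s gr s id p Q (deconcat s t)"
    using Q by (auto simp: coderivation_def)
  have lid: "linear_on fscale fscale ?T ?T id" by (simp add: linear_on_def)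
  note \<mu> = concat_head[OF vs] deconcat_reconstruction[OF vs]
  interpret \<mu>: Vector_Spaces.linear fscale fscale "concat_head s" by (rule \<mu>(1))
  have xT: "pure s [x] \<in> ?T" by (rule pure_in_bar_T) simp
  have zero: "tensor_map s gr s f q g 0 = 0"
    if "linear_on fscale fscale ?T ?T f" "linear_on fscale fscale ?T ?T g" for f g q
  proof -
    have "tensor_map s gr s f q g (\<Sum>i\<in>({} :: nat set). 0) =
        (\<Sum>i\<in>({} :: nat set). tensor_map s gr s f q g 0)"
      by (rule linear_on_sum[OF vector_space_fscale vector_space_fscale
            linear_on_tensor_map[OF gr that]]) (simp_all add: tensor_def)
    then show ?thesis by (simp only: sum.empty)
  qed
  have "deconcat s (pure s [x]) = 0" using deconcat_pure(2)[OF vs, of "[x]"] by simp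
  then have "deconcat s (Q (pure s [x])) = 0"
    unfolding cod[OF xT] by (simp only: zero[OF lQ lid] zero[OF lid lQ] add_0_left)
  moreover have "Q (pure s [x]) \<in> ?T" using lQ xT by (simp add: linear_on_def)
  ultimately show ?thesis
    using \<mu>(3)[of "Q (pure s [x])"] linear_at_0[OF \<mu>(1)] by (simp only: taylor_def add_0_right)
qed

text \<open>The reconstruction formula for \<open>Q (x \<otimes> ws)\<close>. The terms \<open>Q \<otimes> id\<close> of its coproduct contribute one
  summand for each cut; among the terms \<open>id \<otimes> Q\<close>, those whose left factor has exponent larger than
  one vanish under \<open>proj1\<close>, so that only \<open>x \<otimes> Q ws\<close> remains. Hence the degree of \<open>x\<close> alone
  determines the sign.\<close>

lemma coderivation_pure_Cons:
  assumes gr: "graded_vector_space s gr" and Q: "coderivation s gr p Q"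
    and x: "x \<in> gr d" and ws: "ws \<noteq> []"
  shows "Q (pure s (x # ws)) = pure s [taylor s s Q (x # ws)] +
    (\<Sum>i\<in>{1..length ws}. pure s (taylor s s Q (take i (x # ws)) # drop i (x # ws))) +
    fscale (koszul_sign (p * d)) (cons_tensor s x (Q (pure s ws)))"
proof -
  let ?T = "bar_T s" and ?w = "x # ws"
  let ?L = "\<lambda>i. pure s (take i ?w)" and ?R = "\<lambda>i. pure s (drop i ?w)"
  let ?I = "{1..<length ?w}"
  have vs: "vector_space s" using gr by (simp add: graded_vector_space_def)
  have lQ: "linear_on fscale fscale ?T ?T Q"
    and cod: "\<And>t. t \<in> ?T \<Longrightarrow> deconcat s (Q t) =
        tensor_map s gr s Q 0 id (deconcat s t) + tensor_map s gr s id p Q (deconcat s t)"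
    using Q by (auto simp: coderivation_def)
  have lid: "linear_on fscale fscale ?T ?T id" by (simp add: linear_on_def)
  have QT: "Q t \<in> ?T" if "t \<in> ?T" for t using lQ that by (simp add: linear_on_def)
  note \<mu> = concat_head[OF vs] deconcat_reconstruction[OF vs]
  interpret \<mu>: Vector_Spaces.linear fscale fscale "concat_head s" by (rule \<mu>(1))
  have ne: "?L i \<in> ?T" "?R i \<in> ?T" "take i ?w \<noteq> []" "drop i ?w \<noteq> []" if "i \<in> ?I" for i
    using that by (auto intro!: pure_in_bar_T)
  have tens: "pure2 ?T ?T (?L i) (?R i) \<in> tensor ?T ?T" if "i \<in> ?I" for i
    by (rule pure2_in_tensor) (use ne that in auto)
  have map_sum: "concat_head s (tensor_map s gr s f q g (deconcat s (pure s ?w))) =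
      (\<Sum>i\<in>?I. concat_head s (tensor_map s gr s f q g (pure2 ?T ?T (?L i) (?R i))))"
    if f: "linear_on fscale fscale ?T ?T f" and g: "linear_on fscale fscale ?T ?T g" for f g q
  proof -
    have "tensor_map s gr s f q g (\<Sum>i\<in>?I. pure2 ?T ?T (?L i) (?R i)) =
        (\<Sum>i\<in>?I. tensor_map s gr s f q g (pure2 ?T ?T (?L i) (?R i)))"
      by (rule linear_on_sum[OF vector_space_fscale vector_space_fscale
            linear_on_tensor_map[OF gr f g] _ tens]) (simp_all add: tensor_def)
    then show ?thesis by (simp only: deconcat_pure(2)[OF vs list.discI[OF refl]] \<mu>.sum)
  qed
  have left: "concat_head s (tensor_map s gr s Q 0 id (pure2 ?T ?T (?L i) (?R i))) =
      pure s (taylor s s Q (take i ?w) # drop i ?w)" if "i \<in> ?I" for i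
    using tensor_map_degree_0[OF gr lQ lid ne(3)[OF that] ne(2)[OF that]]
      \<mu>(2)[OF QT[OF ne(1)[OF that]] ne(2)[OF that]] cons_tensor_pure[OF vs ne(4)[OF that]]
    by (simp only: id_apply taylor_def)
  have right: "concat_head s (tensor_map s gr s id p Q (pure2 ?T ?T (?L i) (?R i))) =
      (if i = 1 then fscale (koszul_sign (p * d)) (cons_tensor s x (Q (pure s ws))) else 0)"
    if i: "i \<in> ?I" for i
  proof (cases "i = 1")
    case True
    have "\<exists>w ds. pure s [x] = pure s w \<and> w \<noteq> [] \<and> list_all2 (\<lambda>v e. v \<in> gr e) w ds \<and> sum_list ds = d"
      using x by (intro exI[of _ "[x]"] exI[of _ "[d]"]) simp
    then have x1: "pure s [x] \<in> bar_T_deg s gr d"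
      unfolding bar_T_deg_def by (blast intro: fs.span_base)
    show ?thesis
      using True tensor_map_pure2(2)[OF gr lid lQ x1 pure_in_bar_T[OF ws], of p]
        \<mu>(2)[OF pure_in_bar_T QT[OF pure_in_bar_T[OF ws]], of "[x]"]
        proj1_pure(2)[OF vs, of "[x]"]
      by (simp add: \<mu>.scale del: fscale_apply)
  next
    case False
    \<comment> \<open>The left factor may be inhomogeneous here, so no sign can be read off directly: the term
      vanishes by linearity, because it does for homogeneous left factors of the same exponent.\<close>
    have "(\<lambda>a. concat_head s (tensor_map s gr s id p Q (pure2 ?T ?T a (?R i)))) (?L i) = (\<lambda>_. 0) (?L i)"
    proof (rule linear_on_eq_homogeneous[OF gr _ _ vector_space_fscale _ ne(3)[OF i]])
      have "linear_on fscale fscale ?T UNIV (\<lambda>a. tensor_map s gr s id p Q (pure2 ?T ?T a (?R i)))"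
        by (rule linear_on_pure2_left[OF linear_on_tensor_map[OF gr lid lQ] ne(2)[OF i]])
      then show "linear_on fscale fscale ?T UNIV
          (\<lambda>a. concat_head s (tensor_map s gr s id p Q (pure2 ?T ?T a (?R i))))"
        by (simp add: linear_on_def \<mu>.add \<mu>.scale del: fscale_apply plus_fun_apply)
      show "linear_on fscale fscale ?T UNIV (\<lambda>_. 0)"
        unfolding linear_on_def by (simp only: fs.scale_zero_right) simp
      fix w' e assume w': "w' \<noteq> []" "length w' = length (take i ?w)" "pure s w' \<in> bar_T_deg s gr e"
      then have "length w' \<noteq> 1" using i False by auto
      then have "concat_head s (pure2 ?T ?T (pure s w') (Q (?R i))) = cons_tensor s 0 (Q (?R i))"
        using \<mu>(2)[OF pure_in_bar_T[OF w'(1)] QT[OF ne(2)[OF i]]] proj1_pure(2)[OF vs w'(1)] by simp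
      also have "\<dots> = 0" using linear_at_0[OF linear_cons_tensor_left[OF vs QT[OF ne(2)[OF i]]]] .
      finally show "concat_head s (tensor_map s gr s id p Q (pure2 ?T ?T (pure s w') (?R i))) = 0"
        unfolding tensor_map_pure2(2)[OF gr lid lQ w'(3) ne(2)[OF i]]
        by (simp only: id_apply \<mu>.scale fs.scale_zero_right)
    qed
    then show ?thesis using False by simp
  qed
  have "(\<Sum>i\<in>?I. concat_head s (tensor_map s gr s id p Q (pure2 ?T ?T (?L i) (?R i)))) =
      (\<Sum>i\<in>?I. if i = 1 then fscale (koszul_sign (p * d)) (cons_tensor s x (Q (pure s ws))) else 0)"
    by (rule sum.cong[OF refl right])
  also have "\<dots> = fscale (koszul_sign (p * d)) (cons_tensor s x (Q (pure s ws)))"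
    using ws by (subst sum.delta) (auto simp: Suc_le_eq)
  finally have r: "concat_head s (tensor_map s gr s id p Q (deconcat s (pure s ?w))) =
      fscale (koszul_sign (p * d)) (cons_tensor s x (Q (pure s ws)))"
    by (simp only: map_sum[OF lid lQ])
  have l: "concat_head s (tensor_map s gr s Q 0 id (deconcat s (pure s ?w))) =
      (\<Sum>i\<in>?I. pure s (taylor s s Q (take i ?w) # drop i ?w))"
    unfolding map_sum[OF lQ lid] by (rule sum.cong[OF refl left])
  have wT: "pure s ?w \<in> ?T" by (rule pure_in_bar_T) simp
  have I: "?I = {1..length ws}" by auto
  have "Q (pure s ?w) = pure s [taylor s s Q ?w] + concat_head s (deconcat s (Q (pure s ?w)))"
    unfolding taylor_def by (rule \<mu>(3)[OF QT[OF wT]])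
  then show ?thesis unfolding cod[OF wT] \<mu>.add l r I by (simp only: add.assoc)
qed

section \<open>The filtration by tensor exponent\<close>

definition bar_T_upto :: "('k::field \<Rightarrow> 'v::ab_group_add \<Rightarrow> 'v) \<Rightarrow> nat \<Rightarrow> ('v, 'k) tens set" where
  "bar_T_upto s n = fs.span (pure s ` {w. w \<noteq> [] \<and> length w \<le> n})"

lemma subspace_bar_T_upto: "fs.subspace (bar_T_upto s n)"
  by (simp add: bar_T_upto_def)

lemma pure_in_bar_T_upto: "w \<noteq> [] \<Longrightarrow> length w \<le> n \<Longrightarrow> pure s w \<in> bar_T_upto s n"
  unfolding bar_T_upto_def by (rule fs.span_base) blast

lemma cons_tensor_into_subspace:
  assumes vs: "vector_space s" and A: "fs.subspace A"
    and w: "\<And>w. w \<noteq> [] \<Longrightarrow> length w \<le> n \<Longrightarrow> pure s (v # w) \<in> A"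
    and t: "t \<in> bar_T_upto s n"
  shows "cons_tensor s v t \<in> A"
proof -
  interpret l: Vector_Spaces.linear fscale fscale "cons_tensor s v"
    by (rule linear_cons_tensor[OF vs])
  have "cons_tensor s v ` pure s ` {w. w \<noteq> [] \<and> length w \<le> n} \<subseteq> A"
    using w by (auto simp: cons_tensor_pure[OF vs])
  then have "fs.span (cons_tensor s v ` pure s ` {w. w \<noteq> [] \<and> length w \<le> n}) \<subseteq> A"
    using A by (rule fs.span_minimal)
  then show ?thesis using t unfolding bar_T_upto_def l.span_image by blast
qed

text \<open>In the recursion for \<open>Q (x \<otimes> ws)\<close>, each cut replaces the factors before it by a single
  one, and \<open>Q ws\<close> is bounded by induction. Decomposing the first factor into homogeneous parts makes the
  recursion applicable.\<close>

lemma coderivation_preserves_length_filtration: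
  assumes gr: "graded_vector_space s gr" and Q: "coderivation s gr p Q" and w: "w \<noteq> []"
  shows "Q (pure s w) \<in> bar_T_upto s (length w)"
  using w
proof (induction w)
  case (Cons v ws)
  have vs: "vector_space s" using gr by (simp add: graded_vector_space_def)
  show ?case
  proof (cases "ws = []")
    case True
    then show ?thesis
      using coderivation_pure_single[OF gr Q] by (simp add: pure_in_bar_T_upto)
  next
    case False
    let ?U = "bar_T_upto s (length (v # ws))"
    note U = subspace_bar_T_upto[of s "length (v # ws)"]
    have lQ: "linear_on fscale fscale (bar_T s) (bar_T s) Q" using Q by (simp add: coderivation_def)
    have homogeneous: "Q (pure s (x # ws)) \<in> ?U" if x: "x \<in> gr d" for x d
      unfolding coderivation_pure_Cons[OF gr Q x False]
    proof (intro fs.subspace_add[OF U] fs.subspace_sum[OF U] fs.subspace_scale[OF U])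
      show "cons_tensor s x (Q (pure s ws)) \<in> ?U"
        by (rule cons_tensor_into_subspace[OF vs U _ Cons.IH[OF False]])
          (simp add: pure_in_bar_T_upto)
    qed (use False in \<open>auto intro!: pure_in_bar_T_upto\<close>)
    have Q_head: "Vector_Spaces.linear s fscale (\<lambda>v. Q (pure s (v # ws)))"
    proof -
      have "pure s (v # ws) \<in> bar_T s" for v by (rule pure_in_bar_T) simp
      then show ?thesis using lQ linear_pure[OF vs, of "[]" ws]
        by (simp add: linear_on_def Vector_Spaces.linear_iff)
    qed
    interpret l: Vector_Spaces.linear s fscale "\<lambda>v. Q (pure s (v # ws))" by (rule Q_head)
    have "(\<lambda>v. Q (pure s (v # ws))) ` (\<Union>i. gr i) \<subseteq> ?U" using homogeneous by blast
    then have "fs.span ((\<lambda>v. Q (pure s (v # ws))) ` (\<Union>i. gr i)) \<subseteq> ?U"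
      using U by (rule fs.span_minimal)
    then show ?thesis using graded_span[OF gr, of v] unfolding l.span_image by blast
  qed
qed simp

text \<open>In the recursion for \<open>F w\<close> the Taylor coefficient of full arity occurs only at \<open>w\<close> itself.\<close>

lemma coalgebra_morphism_eq_pure:
  assumes gr: "graded_vector_space s gr" and W: "vector_space s'"
    and F: "linear_on fscale fscale (bar_T s) (bar_T s') F"
      "\<And>t. t \<in> bar_T s \<Longrightarrow> deconcat s' (F t) = tensor_map s gr s' F 0 F (deconcat s t)"
    and F': "linear_on fscale fscale (bar_T s) (bar_T s') F'"
      "\<And>t. t \<in> bar_T s \<Longrightarrow> deconcat s' (F' t) = tensor_map s gr s' F' 0 F' (deconcat s t)"
    and w: "w \<noteq> []"
    and eq: "taylor s s' F w = taylor s s' F' w"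
      "\<And>u. u \<noteq> [] \<Longrightarrow> length u < length w \<Longrightarrow> taylor s s' F u = taylor s s' F' u"
  shows "F (pure s w) = F' (pure s w)"
  using w eq
proof (induction "length w" arbitrary: w rule: less_induct)
  case less
  note rec = coalgebra_morphism_pure[OF gr W F less.prems(1)]
    coalgebra_morphism_pure[OF gr W F' less.prems(1)]
  have "(\<Sum>i\<in>{1..<length w}. cons_tensor s' (taylor s s' F (take i w)) (F (pure s (drop i w)))) =
    (\<Sum>i\<in>{1..<length w}. cons_tensor s' (taylor s s' F' (take i w)) (F' (pure s (drop i w))))"
  proof (rule sum.cong[OF refl])
    fix i assume i: "i \<in> {1..<length w}"
    have "taylor s s' F (take i w) = taylor s s' F' (take i w)"
      using i by (intro less.prems(3)) auto
    moreover have "F (pure s (drop i w)) = F' (pure s (drop i w))"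
      using i by (intro less.hyps less.prems(3)) auto
    ultimately show "cons_tensor s' (taylor s s' F (take i w)) (F (pure s (drop i w))) =
      cons_tensor s' (taylor s s' F' (take i w)) (F' (pure s (drop i w)))" by simp
  qed
  then show ?case using rec less.prems(2) by (simp only:)
qed

section \<open>Uniqueness of the morphism\<close>

text \<open>The key step: both morphisms commute with the differentials and agree at \<open>x \<otimes> ws\<close>, hence at
  \<open>Q (x \<otimes> ws)\<close>; and \<open>Q\<^sub>1 x \<otimes> ws\<close> is the only summand of this tensor at which their agreement is not
  already known.\<close>

lemma taylor_eq_on_differentials:
  assumes V: "A_infinity_algebra sV grV Q" and W: "A_infinity_algebra sW grW R"
    and G: "A_infinity_morphism sV grV Q sW grW R G"
    and G': "A_infinity_morphism sV grV Q sW grW R G'"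
    and X: "graded_subspace sV grV X"
    and eq_X: "\<And>v u. v \<in> X \<Longrightarrow> taylor sV sW G (v # u) = taylor sV sW G' (v # u)"
    and ws: "ws \<noteq> []"
    and eq_less: "\<And>u. u \<noteq> [] \<Longrightarrow> length u \<le> length ws \<Longrightarrow> taylor sV sW G u = taylor sV sW G' u"
    and x: "x \<in> X"
  shows "taylor sV sW G (taylor sV sV Q [x] # ws) = taylor sV sW G' (taylor sV sV Q [x] # ws)"
proof -
  let ?gr = "suspension grV" and ?q = "taylor sV sV Q"
  have gr: "graded_vector_space sV ?gr"
    using V graded_vector_space_suspension by (auto simp: A_infinity_algebra_def)
  have V': "vector_space sV" and W': "vector_space sW"
    using V W by (auto simp: A_infinity_algebra_def graded_vector_space_def)
  interpret vector_space sV by fact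
  have Q: "coderivation sV ?gr 1 Q" using V by (simp add: A_infinity_algebra_def)
  have lQ: "linear_on fscale fscale (bar_T sV) (bar_T sV) Q" using Q by (simp add: coderivation_def)
  have lG: "linear_on fscale fscale (bar_T sV) (bar_T sW) G"
      "linear_on fscale fscale (bar_T sV) (bar_T sW) G'"
    and coalg: "\<And>t. t \<in> bar_T sV \<Longrightarrow> deconcat sW (G t) = tensor_map sV ?gr sW G 0 G (deconcat sV t)"
      "\<And>t. t \<in> bar_T sV \<Longrightarrow> deconcat sW (G' t) = tensor_map sV ?gr sW G' 0 G' (deconcat sV t)"
    and comm: "\<And>t. t \<in> bar_T sV \<Longrightarrow> G (Q t) = R (G t)"
      "\<And>t. t \<in> bar_T sV \<Longrightarrow> G' (Q t) = R (G' t)"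
    using G G' by (auto simp: A_infinity_morphism_def)
  note eq_pure = coalgebra_morphism_eq_pure[OF gr W' lG(1) coalg(1) lG(2) coalg(2)]
  \<comment> \<open>The equalizer of the two morphisms; being a subspace, it contains a summand once it contains
    the sum and the other summands.\<close>
  define A where "A = {t \<in> bar_T sV. G t = G' t}"
  have A: "fs.subspace A"
  proof (rule fs.subspaceI)
    have z: "G (fscale 0 0) = fscale 0 (G 0)" "G' (fscale 0 0) = fscale 0 (G' 0)"
      using lG fs.subspace_0[OF subspace_bar_T] unfolding linear_on_def by blast+
    then have "G 0 = 0" "G' 0 = 0" by (simp_all only: fs.scale_zero_left)
    then show "0 \<in> A" using fs.subspace_0[OF subspace_bar_T] by (simp add: A_def)
    show "t + t' \<in> A" if "t \<in> A" "t' \<in> A" for t t'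
    proof -
      have "t \<in> bar_T sV" "t' \<in> bar_T sV" using that by (simp_all add: A_def)
      then have "t + t' \<in> bar_T sV" by (rule fs.subspace_add[OF subspace_bar_T])
      then show ?thesis using that lG unfolding linear_on_def A_def by simp
    qed
    show "fscale c t \<in> A" if "t \<in> A" for c t
    proof -
      have "t \<in> bar_T sV" using that by (simp add: A_def)
      then have "fscale c t \<in> bar_T sV" by (rule fs.subspace_scale[OF subspace_bar_T])
      then show ?thesis using that lG unfolding linear_on_def A_def by simp
    qed
  qed
  have pure_A: "pure sV u \<in> A" if "u \<noteq> []" "length u \<le> length ws" for u
    using that eq_less unfolding A_def by (auto intro!: pure_in_bar_T eq_pure)
  have pure_X_A: "pure sV (v # u) \<in> A" if "v \<in> X" "length u \<le> length ws" for v u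
    using that eq_less eq_X unfolding A_def by (auto intro!: pure_in_bar_T eq_pure)
  have homogeneous: "pure sV (?q [x] # ws) \<in> A" if x: "x \<in> X" "x \<in> ?gr d" for x d
  proof -
    let ?t = "pure sV (x # ws)"
    have tT: "?t \<in> bar_T sV" by (rule pure_in_bar_T) simp
    have "G ?t = G' ?t" using pure_X_A[OF x(1)] by (simp add: A_def)
    moreover have "Q ?t \<in> bar_T sV" using lQ tT by (simp add: linear_on_def)
    ultimately have QA: "Q ?t \<in> A" using comm tT by (simp add: A_def)
    \<comment> \<open>The cut after the first factor gives \<open>Q\<^sub>1 x \<otimes> ws\<close>; the later cuts give smaller exponents.\<close>
    have I: "{1..length ws} = insert 1 {2..length ws}" using ws by (auto simp: Suc_le_eq)
    let ?low = "\<Sum>i\<in>{2..length ws}. pure sV (?q (take i (x # ws)) # drop i (x # ws))"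
    let ?tail = "fscale (koszul_sign (1 * d)) (cons_tensor sV x (Q (pure sV ws)))"
    have "Q ?t = pure sV [?q (x # ws)] + (pure sV (?q [x] # ws) + ?low) + ?tail"
      unfolding coderivation_pure_Cons[OF gr Q x(2) ws] I by simp
    then have "pure sV (?q [x] # ws) = Q ?t - pure sV [?q (x # ws)] - ?low - ?tail"
      by (simp add: algebra_simps)
    also have "\<dots> \<in> A"
    proof (intro fs.subspace_diff[OF A] fs.subspace_sum[OF A] fs.subspace_scale[OF A] QA)
      show "pure sV [?q (x # ws)] \<in> A" using ws by (intro pure_A) (auto simp: Suc_le_eq)
      show "pure sV (?q (take i (x # ws)) # drop i (x # ws)) \<in> A" if "i \<in> {2..length ws}" for i
        using that by (intro pure_A) auto
      show "cons_tensor sV x (Q (pure sV ws)) \<in> A"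
        by (rule cons_tensor_into_subspace[OF V' A _
              coderivation_preserves_length_filtration[OF gr Q ws]]) (rule pure_X_A[OF x(1)])
    qed
    finally show ?thesis .
  qed
  let ?f = "\<lambda>F x. taylor sV sW F (?q [x] # ws)"
  have "Vector_Spaces.linear sV sW (?f F)" if "linear_on fscale fscale (bar_T sV) (bar_T sW) F" for F
    using Vector_Spaces.linear_compose[OF linear_taylor[OF V' V' lQ, of "[]" "[]"]
        linear_taylor[OF V' W' that, of "[]" ws]] by (simp add: comp_def)
  note lin = this[OF lG(1)] this[OF lG(2)]
  interpret p: vector_space_pair sV sW using V' W' by (simp add: vector_space_pair_def)
  have X_span: "x \<in> span (\<Union>i. X \<inter> grV i)" using X x unfolding graded_subspace_def by metis
  have "?f G u = ?f G' u" if u: "u \<in> (\<Union>i. X \<inter> grV i)" for u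
  proof -
    \<comment> \<open>Suspension shifts degrees by one, so degree \<open>i\<close> in \<open>V\<close> is degree \<open>i - 1\<close> in its suspension.\<close>
    obtain i where "u \<in> X" "u \<in> ?gr (i - 1)" using u by (auto simp: suspension_def)
    then show ?thesis using homogeneous by (simp add: A_def taylor_def)
  qed
  then show ?thesis using p.linear_eq_on_span[OF lin _ X_span] by blast
qed

text \<open>Induction on the arity, with the first argument split along \<open>V = X + Q\<^sub>1 X\<close>.\<close>

lemma A_infinity_morphism_eqI:
  assumes V: "A_infinity_algebra sV grV Q"
    and X: "graded_subspace sV grV X"
    and XY: "direct_sum_decomposition X Y"
    and Y_sub: "Y \<subseteq> (\<lambda>x. taylor sV sV Q [x]) ` X"
    and W: "A_infinity_algebra sW grW R"
    and G: "A_infinity_morphism sV grV Q sW grW R G"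
    and G': "A_infinity_morphism sV grV Q sW grW R G'"
    and eq1: "\<And>v. taylor sV sW G [v] = taylor sV sW G' [v]"
    and eq_X: "\<And>v ws. v \<in> X \<Longrightarrow> taylor sV sW G (v # ws) = taylor sV sW G' (v # ws)"
    and t: "t \<in> bar_T sV"
  shows "G t = G' t"
proof -
  have gr: "graded_vector_space sV (suspension grV)"
    using V graded_vector_space_suspension by (auto simp: A_infinity_algebra_def)
  have V': "vector_space sV" and W': "vector_space sW"
    using V W by (auto simp: A_infinity_algebra_def graded_vector_space_def)
  have lG: "linear_on fscale fscale (bar_T sV) (bar_T sW) G"
      "linear_on fscale fscale (bar_T sV) (bar_T sW) G'"
    and coalg: "\<And>t. t \<in> bar_T sV \<Longrightarrow>
        deconcat sW (G t) = tensor_map sV (suspension grV) sW G 0 G (deconcat sV t)"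
      "\<And>t. t \<in> bar_T sV \<Longrightarrow>
        deconcat sW (G' t) = tensor_map sV (suspension grV) sW G' 0 G' (deconcat sV t)"
    using G G' by (auto simp: A_infinity_morphism_def)
  have taylor_eq: "taylor sV sW G w = taylor sV sW G' w" if "w \<noteq> []" for w
    using that
  proof (induction "length w" arbitrary: w rule: less_induct)
    case less
    then obtain v ws where w: "w = v # ws" by (cases w) auto
    show ?case
    proof (cases "ws = []")
      case True
      then show ?thesis using w eq1 by simp
    next
      case False
      obtain x y where xy: "x \<in> X" "y \<in> Y" "v = x + y"
        using XY unfolding direct_sum_decomposition_def by blast
      obtain x' where x': "x' \<in> X" "y = taylor sV sV Q [x']" using Y_sub xy(2) by blast
      have "taylor sV sW G (y # ws) = taylor sV sW G' (y # ws)"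
        unfolding x'(2)
        by (rule taylor_eq_on_differentials[OF V W G G' X eq_X False _ x'(1)])
          (use less.hyps w in auto)
      then show ?thesis
        using eq_X[OF xy(1), of ws] linear_taylor[OF V' W' lG(1), of "[]" ws]
          linear_taylor[OF V' W' lG(2), of "[]" ws] w xy(3)
        by (simp add: Vector_Spaces.linear_iff)
    qed
  qed
  show ?thesis
    by (rule linear_on_eq_bar_T[OF lG(1) lG(2) _ vector_space_fscale t])
      (intro coalgebra_morphism_eq_pure[OF gr W' lG(1) coalg(1) lG(2) coalg(2)] taylor_eq)
qed

text \<open>The second part is an instance of the first: when an argument lies in \<open>X\<close>, the higher Taylor
  coefficients of the two morphisms agree because both vanish, and those of arity one because the
  linear parts are the same.\<close>

theorem lemma2p11:
  fixes sV :: "'k::field_char_0 \<Rightarrow> 'v::ab_group_add \<Rightarrow> 'v" and grV :: "int \<Rightarrow> 'v set"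
    and Q :: "('v, 'k) tens \<Rightarrow> ('v, 'k) tens"
    and sW :: "'k \<Rightarrow> 'w::ab_group_add \<Rightarrow> 'w" and grW :: "int \<Rightarrow> 'w set"
    and R :: "('w, 'k) tens \<Rightarrow> ('w, 'k) tens"
    and X Y :: "'v set"
  assumes V: "A_infinity_algebra sV grV Q"
    and X: "graded_subspace sV grV X" and Y: "graded_subspace sV grV Y"
    and XY: "direct_sum_decomposition X Y"
    and Y_sub: "Y \<subseteq> (\<lambda>x. taylor sV sV Q [x]) ` X"
    and W: "A_infinity_algebra sW grW R"
  shows
    "(\<forall>G G'. A_infinity_morphism sV grV Q sW grW R G \<and> A_infinity_morphism sV grV Q sW grW R G' \<and>
        (\<forall>v. taylor sV sW G [v] = taylor sV sW G' [v]) \<and>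
        (\<forall>vs. (\<exists>v\<in>set vs. v \<in> X) \<longrightarrow> taylor sV sW G vs = taylor sV sW G' vs)
        \<longrightarrow> (\<forall>t \<in> bar_T sV. G t = G' t))
     \<and>
     (\<forall>L :: 'v \<Rightarrow> 'w. \<forall>F F'.
        A_infinity_morphism sV grV Q sW grW R F \<and> (\<forall>v. taylor sV sW F [v] = L v) \<and>
        (\<forall>vs. length vs \<ge> 2 \<and> (\<exists>v\<in>set vs. v \<in> X) \<longrightarrow> taylor sV sW F vs = 0) \<and>
        A_infinity_morphism sV grV Q sW grW R F' \<and> (\<forall>v. taylor sV sW F' [v] = L v) \<and>
        (\<forall>vs. length vs \<ge> 2 \<and> (\<exists>v\<in>set vs. v \<in> X) \<longrightarrow> taylor sV sW F' vs = 0)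
        \<longrightarrow> (\<forall>t \<in> bar_T sV. F t = F' t))"
proof -
  note eqI = A_infinity_morphism_eqI[OF V X XY Y_sub W]
  show ?thesis
  proof (intro conjI allI, goal_cases)
    case (1 G G')
    show ?case
    proof (intro impI ballI, elim conjE)
      fix t
      assume G: "A_infinity_morphism sV grV Q sW grW R G" "A_infinity_morphism sV grV Q sW grW R G'"
        and linear_part: "\<forall>v. taylor sV sW G [v] = taylor sV sW G' [v]"
        and on_X: "\<forall>vs. (\<exists>v\<in>set vs. v \<in> X) \<longrightarrow> taylor sV sW G vs = taylor sV sW G' vs"
        and t: "t \<in> bar_T sV"
      have "taylor sV sW G (v # ws) = taylor sV sW G' (v # ws)" if "v \<in> X" for v ws
        using on_X that by simp
      from eqI[OF G spec[OF linear_part] this t] show "G t = G' t" .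
    qed
  next
    case (2 L F F')
    show ?case
    proof (intro impI ballI, elim conjE)
      fix t
      assume F: "A_infinity_morphism sV grV Q sW grW R F" "A_infinity_morphism sV grV Q sW grW R F'"
        and L: "\<forall>v. taylor sV sW F [v] = L v" "\<forall>v. taylor sV sW F' [v] = L v"
        and X0: "\<forall>vs. length vs \<ge> 2 \<and> (\<exists>v\<in>set vs. v \<in> X) \<longrightarrow> taylor sV sW F vs = 0"
          "\<forall>vs. length vs \<ge> 2 \<and> (\<exists>v\<in>set vs. v \<in> X) \<longrightarrow> taylor sV sW F' vs = 0"
        and t: "t \<in> bar_T sV"
      have linear_part: "taylor sV sW F [v] = taylor sV sW F' [v]" for v using L by simp
      have on_X: "taylor sV sW F (v # ws) = taylor sV sW F' (v # ws)" if v: "v \<in> X" for v ws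
      proof (cases "ws = []")
        case True
        then show ?thesis using linear_part by simp
      next
        case False
        then have "length (v # ws) \<ge> 2 \<and> (\<exists>v\<in>set (v # ws). v \<in> X)"
          using v by (auto simp: Suc_le_eq)
        then show ?thesis using X0[THEN spec, of "v # ws"] by simp
      qed
      from eqI[OF F linear_part on_X t] show "F t = F' t" .
    qed
  qed
qed

end
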